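(* Let $P$ be a finite poset and $K$ a field. Then the squarefree monomial ideal $H_P\subset S=K[\{x_p,y_p\}_{p\in P}]$ is of height $2$, and the multiplicity of $S/H_P$ is given by $$e(S/H_P)=|\{(p,q): p,q\in P,\ p\le q\}|.$$
   Context: A poset ideal of a finite poset $P$ is a subset $I\subset P$ such that $x\in I$, $y\in P$, $y\le x$ imply $y\in I$ ($\emptyset$ and $P$ are poset ideals). $\mathcal{J}(P)$ is the set of all poset ideals of $P$, ordered by inclusion. $S=K[\{x_p,y_p\}_{p\in P}]$ is the polynomial ring in $2|P|$ variables over $K$ with all variables of degree $1$. For $I\in\mathcal{J}(P)$ set $u_I=\bigl(\prod_{p\in I}x_p\bigr)\bigl(\prod_{p\in P\setminus I}y_p\bigr)$, and $H_P\subset S$ is the ideal generated by all $u_I$, $I\in\mathcal{J}(P)$. $e(S/H_P)$ is the multiplicity (degree) of the standard graded $K$-algebra $S/H_P$. *)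

theory Defs
  imports
    "HOL-Algebra.Algebra"
    "HOL-Algebra.Algebraic_Closure_Type"
    "HOL-Library.Extended_Nat"
    "HOL-Library.Poly_Mapping"
    "HOL-Computational_Algebra.Formal_Power_Series"
    "HOL-Computational_Algebra.Polynomial_FPS"
begin

subsection \<open>Prime ideal chains, height and Krull dimension\<close>

definition prime_chain :: "('a, 'm) ring_scheme \<Rightarrow> 'a set list \<Rightarrow> bool" where
  "prime_chain R ps \<longleftrightarrow>
     ps \<noteq> [] \<and> (\<forall>p \<in> set ps. primeideal p R) \<and> sorted_wrt (\<subset>) ps"

text \<open>A chain of \<open>n + 1\<close> prime ideals has length \<open>n\<close>, whence the \<open>- 1\<close> below.\<close>

definition prime_height :: "('a, 'm) ring_scheme \<Rightarrow> 'a set \<Rightarrow> enat" where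
  "prime_height R p = (SUP ps \<in> {ps. prime_chain R ps \<and> last ps = p}. enat (length ps - 1))"

definition ideal_height :: "('a, 'm) ring_scheme \<Rightarrow> 'a set \<Rightarrow> enat" where
  "ideal_height R I = (INF p \<in> {p. primeideal p R \<and> I \<subseteq> p}. prime_height R p)"

definition krull_dim :: "('a, 'm) ring_scheme \<Rightarrow> enat" where
  "krull_dim R = (SUP ps \<in> {ps. prime_chain R ps}. enat (length ps - 1))"

subsection \<open>Polynomial rings in finitely many variables\<close>

text \<open>
  An element of type \<open>('v, 'k) mpol\<close> is a polynomial whose variables are indexed by \<open>'v\<close>:
  a finitely supported map from exponent vectors \<open>'v \<Rightarrow>\<^sub>0 nat\<close> to coefficients.
\<close>

type_synonym ('v, 'k) mpol = "('v \<Rightarrow>\<^sub>0 nat) \<Rightarrow>\<^sub>0 'k"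

abbreviation mpol_ring :: "('v, 'k::field) mpol ring" where
  "mpol_ring \<equiv> ring_of_type_algebra"

definition mpol_var :: "'v \<Rightarrow> ('v, 'k::field) mpol" where
  "mpol_var v = Poly_Mapping.single (Poly_Mapping.single v 1) 1"

definition mpol_const :: "'k::field \<Rightarrow> ('v, 'k) mpol" where
  "mpol_const c = Poly_Mapping.single 0 c"

definition monom_deg :: "('v \<Rightarrow>\<^sub>0 nat) \<Rightarrow> nat" where
  "monom_deg m = (\<Sum>v \<in> Poly_Mapping.keys m. Poly_Mapping.lookup m v)"

definition homog_part :: "nat \<Rightarrow> ('v, 'k::field) mpol set" where
  "homog_part n = {f. \<forall>m \<in> Poly_Mapping.keys f. monom_deg m = n}"

subsection \<open>Hilbert series and multiplicity of \<open>S/I\<close> for a homogeneous ideal \<open>I\<close>\<close>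

text \<open>
  The dimension over \<open>K\<close> of the degree \<open>n\<close> component of \<open>S/I\<close>. The latter is the image of
  the degree \<open>n\<close> component of \<open>S\<close>, and \<open>K\<close> acts through its image in \<open>S/I\<close>.
\<close>

definition hilbert_fun :: "('v, 'k::field) mpol set \<Rightarrow> nat \<Rightarrow> nat" where
  "hilbert_fun I n =
     ring.dim (mpol_ring Quot I)
       ((\<lambda>c. I +>\<^bsub>mpol_ring\<^esub> mpol_const c) ` UNIV)
       ((\<lambda>f. I +>\<^bsub>mpol_ring\<^esub> f) ` homog_part n)"

definition hilbert_series :: "('v, 'k::field) mpol set \<Rightarrow> int fps" where
  "hilbert_series I = Abs_fps (\<lambda>n. int (hilbert_fun I n))"

text \<open>
  By the Hilbert--Serre theorem, the Hilbert series of \<open>S/I\<close> is \<open>Q(t) / (1 - t)^d\<close> with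
  \<open>d = dim S/I\<close> and \<open>Q\<close> an integer polynomial; the multiplicity of \<open>S/I\<close> is \<open>Q(1)\<close>.
  For \<open>d > 0\<close> this is \<open>(d - 1)!\<close> times the leading coefficient of the Hilbert polynomial,
  and for \<open>d = 0\<close> it is the length of \<open>S/I\<close>.
\<close>

definition multiplicity_quot :: "('v::finite, 'k::field) mpol set \<Rightarrow> int" where
  "multiplicity_quot I =
     (let d = the_enat (krull_dim (mpol_ring Quot I));
          Q = (THE Q. fps_of_poly Q = hilbert_series I * (1 - fps_X) ^ d)
      in Polynomial.poly Q 1)"

subsection \<open>The ideal \<open>H\<^sub>P\<close>\<close>

text \<open>
  The poset is the type \<open>'p\<close> itself. The variables are indexed by \<open>'p + 'p\<close>, with
  \<open>x\<^sub>p\<close> and \<open>y\<^sub>p\<close> being the variables of index \<open>Inl p\<close> and \<open>Inr p\<close>.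
\<close>

definition poset_ideals :: "'p::order set set" where
  "poset_ideals = {I. \<forall>x \<in> I. \<forall>y. y \<le> x \<longrightarrow> y \<in> I}"

definition u_gen :: "'p::finite set \<Rightarrow> ('p + 'p, 'k::field) mpol" where
  "u_gen I = (\<Prod>p \<in> I. mpol_var (Inl p)) * (\<Prod>p \<in> UNIV - I. mpol_var (Inr p))"

definition H_ideal :: "('p::{finite,order} + 'p, 'k::field) mpol set" where
  "H_ideal = Idl\<^bsub>mpol_ring\<^esub> (u_gen ` poset_ideals)"

end

theory Submission
  imports Defs "HOL-Library.Cardinality"
begin

text \<open>
  A monomial fails to lie in \<open>H\<^sub>P\<close> iff there are \<open>p \<le> q\<close> such that neither \<open>x\<^sub>p\<close> nor \<open>y\<^sub>q\<close>
  divides it, so \<open>H\<^sub>P\<close> is the intersection of the primes \<open>(x\<^sub>p, y\<^sub>q)\<close> with \<open>p \<le> q\<close>, and every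
  prime containing \<open>H\<^sub>P\<close> contains one of these. Expanding the Hilbert series over the supports
  \<open>F\<close> of the monomials outside \<open>H\<^sub>P\<close> gives \<open>\<Sum>F. (t / (1 - t))^|F|\<close>; after multiplication by
  \<open>(1 - t)^d\<close> with \<open>d = 2|P| - 2\<close>, only the supports of size \<open>d\<close>, that is, the complements of the
  sets \<open>{x\<^sub>p, y\<^sub>q}\<close> with \<open>p \<le> q\<close>, survive at \<open>t = 1\<close>.

  The height of \<open>H\<^sub>P\<close> and the dimension of \<open>S/H\<^sub>P\<close> only need that a chain of primes in a polynomial
  ring in \<open>m\<close> variables has length at most \<open>m\<close>, because chains can be concatenated at a monomial
  prime. If \<open>P\<^sub>0 \<subset> \<dots> \<subset> P\<^sub>k\<close> are primes and \<open>g\<^sub>i \<in> P\<^sub>i - P\<^sub>i\<^sub>-\<^sub>1\<close>, then the power products of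
  \<open>g\<^sub>1, \<dots>, g\<^sub>k\<close> are linearly independent modulo \<open>P\<^sub>0\<close>. Those with exponents below \<open>J\<close> number \<open>J^k\<close>
  and lie in a space of dimension \<open>O(J^m)\<close>, whence \<open>k \<le> m\<close>.
\<close>

subsection \<open>Ideals of a commutative ring type\<close>

lemma ideal_type_algebra_iff:
  fixes I :: "'a::comm_ring_1 set"
  shows "ideal I ring_of_type_algebra \<longleftrightarrow>
     0 \<in> I \<and> (\<forall>a\<in>I. \<forall>b\<in>I. a + b \<in> I) \<and> (\<forall>a. \<forall>b\<in>I. a * b \<in> I)" (is "_ \<longleftrightarrow> ?rhs")
proof
  let ?R = "ring_of_type_algebra :: 'a ring"
  assume "ideal I ?R"
  then interpret I: ideal I ?R .
  show ?rhs
    using additive_subgroup.a_closed[OF I.additive_subgroup_axioms] I.I_l_closed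
      additive_subgroup.zero_closed[OF I.additive_subgroup_axioms]
    by (auto simp: ring_of_type_algebra_def)
next
  let ?R = "ring_of_type_algebra :: 'a ring"
  assume r: ?rhs
  interpret R: cring ?R by rule
  \<comment> \<open>Negation is multiplication by \<open>-1\<close>, so absorption of products
    supplies the negatives.\<close>
  have minus: "- a \<in> I" if "a \<in> I" for a using that r by (metis mult_minus1)
  have right: "a * x \<in> I" if "a \<in> I" for a x using that r by (metis mult.commute)
  show "ideal I ?R"
  proof (rule idealI[OF R.ring_axioms])
    show "subgroup I (add_monoid ?R)"
    proof (rule R.add.subgroupI)
      fix a assume "a \<in> I"
      moreover have "\<ominus>\<^bsub>?R\<^esub> a = - a"
        by (rule R.minus_equality) (auto simp: ring_of_type_algebra_def)
      ultimately show "\<ominus>\<^bsub>?R\<^esub> a \<in> I" using minus by simp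
    qed (use r in \<open>auto simp: ring_of_type_algebra_def\<close>)
  qed (use r right in \<open>auto simp: ring_of_type_algebra_def\<close>)
qed

lemma primeideal_type_algebra_iff:
  fixes P :: "'a::comm_ring_1 set"
  shows "primeideal P ring_of_type_algebra \<longleftrightarrow>
     0 \<in> P \<and> (\<forall>a\<in>P. \<forall>b\<in>P. a + b \<in> P) \<and> (\<forall>a. \<forall>b\<in>P. a * b \<in> P) \<and> 1 \<notin> P \<and>
     (\<forall>a b. a * b \<in> P \<longrightarrow> a \<in> P \<or> b \<in> P)" (is "_ \<longleftrightarrow> ?rhs")
proof
  let ?R = "ring_of_type_algebra :: 'a ring"
  assume "primeideal P ?R"
  then interpret P: primeideal P ?R .
  have "1 \<notin> P" using P.I_notcarr P.one_imp_carrier by (auto simp: ring_of_type_algebra_def)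
  then show ?rhs
    using P.ideal_axioms[unfolded ideal_type_algebra_iff] P.I_prime
    by (auto simp: ring_of_type_algebra_def)
next
  let ?R = "ring_of_type_algebra :: 'a ring"
  assume r: ?rhs
  interpret R: cring ?R by rule
  have "ideal P ?R" using r by (simp add: ideal_type_algebra_iff)
  moreover have "carrier ?R \<noteq> P" using r by (auto simp: ring_of_type_algebra_def)
  ultimately show "primeideal P ?R"
    using r by (intro primeidealI R.is_cring) (auto simp: ring_of_type_algebra_def)
qed

lemma ideal_sum_closed:
  fixes I :: "'a::comm_ring_1 set"
  assumes "ideal I ring_of_type_algebra" "\<And>x. x \<in> A \<Longrightarrow> f x \<in> I"
  shows "sum f A \<in> I"
  using assms by (induction A rule: infinite_finite_induct) (auto simp: ideal_type_algebra_iff)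

lemma ideal_mult_closed:
  fixes I :: "'a::comm_ring_1 set"
  assumes "ideal I ring_of_type_algebra" "b \<in> I"
  shows "a * b \<in> I" "b * a \<in> I"
  using assms by (auto simp: ideal_type_algebra_iff mult.commute[of b])

lemma ideal_prod_closed:
  fixes I :: "'a::comm_ring_1 set"
  assumes "ideal I ring_of_type_algebra" "finite A" "x \<in> A" "f x \<in> I"
  shows "prod f A \<in> I"
  using assms by (simp add: prod.remove ideal_mult_closed)

lemma primeideal_prod_memD:
  fixes P :: "'a::comm_ring_1 set"
  assumes "primeideal P ring_of_type_algebra" "prod f A \<in> P"
  shows "\<exists>x\<in>A. f x \<in> P"
  using assms(2)
proof (induction A rule: infinite_finite_induct)
  case (insert x A)
  then have "f x \<in> P \<or> prod f A \<in> P" using assms(1) by (simp add: primeideal_type_algebra_iff)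
  with insert.IH show ?case by blast
qed (use assms(1) in \<open>auto simp: primeideal_type_algebra_iff\<close>)

subsection \<open>Monomial prime ideals\<close>

text \<open>The sum \<open>a + b\<close> of the lexicographically largest elements, built one coordinate at a time.\<close>

lemma unique_sum_on:
  fixes A B :: "('v \<Rightarrow>\<^sub>0 nat) set"
  assumes "finite V" "finite A" "finite B" "A \<noteq> {}" "B \<noteq> {}"
  shows "\<exists>a\<in>A. \<exists>b\<in>B. \<forall>a'\<in>A. \<forall>b'\<in>B.
           (\<forall>v\<in>V. Poly_Mapping.lookup (a' + b') v = Poly_Mapping.lookup (a + b) v) \<longrightarrow>
           (\<forall>v\<in>V. Poly_Mapping.lookup a' v = Poly_Mapping.lookup a v \<and>
                   Poly_Mapping.lookup b' v = Poly_Mapping.lookup b v)"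
  using assms
proof (induction V arbitrary: A B rule: finite_induct)
  case empty
  then show ?case by blast
next
  case (insert v V)
  let ?l = Poly_Mapping.lookup
  define M where "M C = Max ((\<lambda>m. ?l m v) ` C)" for C :: "('v \<Rightarrow>\<^sub>0 nat) set"
  define top where "top C = {m \<in> C. ?l m v = M C}" for C
  have le: "?l m v \<le> M C" if "m \<in> C" "finite C" for m C
    using that by (auto simp: M_def)
  have ne: "top C \<noteq> {}" if "finite C" "C \<noteq> {}" for C
  proof -
    have "M C \<in> (\<lambda>m. ?l m v) ` C" unfolding M_def using that by (intro Max_in) auto
    then show ?thesis by (auto simp: top_def)
  qed
  have "finite (top A)" "finite (top B)" using insert.prems by (auto simp: top_def)
  with insert.IH[of "top A" "top B"] ne insert.prems
  obtain a b where ab: "a \<in> top A" "b \<in> top B"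
    and u: "\<And>a' b'. a' \<in> top A \<Longrightarrow> b' \<in> top B \<Longrightarrow> \<forall>v\<in>V. ?l (a' + b') v = ?l (a + b) v \<Longrightarrow>
             \<forall>v\<in>V. ?l a' v = ?l a v \<and> ?l b' v = ?l b v"
    by blast
  show ?case
  proof (rule bexI[of _ a], rule bexI[of _ b], intro ballI impI)
    fix a' b' w
    assume a': "a' \<in> A" and b': "b' \<in> B" and w: "w \<in> insert v V"
      and eq: "\<forall>w\<in>insert v V. ?l (a' + b') w = ?l (a + b) w"
    \<comment> \<open>Each exponent is at most its maximum and the sums agree, so both maxima are
      attained. Hence \<open>a'\<close> and \<open>b'\<close> lie in the sets to which the induction
      hypothesis applies.\<close>
    have "?l a' v \<le> ?l a v" "?l b' v \<le> ?l b v"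
      using le[of a' A] le[of b' B] a' b' insert.prems ab by (auto simp: top_def)
    moreover have "?l a' v + ?l b' v = ?l a v + ?l b v" using eq by (simp add: lookup_add)
    ultimately have v: "?l a' v = ?l a v" "?l b' v = ?l b v" by auto
    then have "a' \<in> top A" "b' \<in> top B" using a' b' ab by (auto simp: top_def)
    then show "?l a' w = ?l a w \<and> ?l b' w = ?l b w"
      using u[of a' b'] v w eq by auto
  qed (use ab in \<open>auto simp: top_def\<close>)
qed

lemma unique_sum:
  fixes A B :: "('v::finite \<Rightarrow>\<^sub>0 nat) set"
  assumes "finite A" "finite B" "A \<noteq> {}" "B \<noteq> {}"
  obtains a b where "a \<in> A" "b \<in> B"
    "\<And>a' b'. a' \<in> A \<Longrightarrow> b' \<in> B \<Longrightarrow> a' + b' = a + b \<Longrightarrow> a' = a \<and> b' = b"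
proof -
  from unique_sum_on[OF finite[of UNIV] assms] obtain a b where "a \<in> A" "b \<in> B"
    and u: "\<forall>a'\<in>A. \<forall>b'\<in>B.
           (\<forall>v\<in>UNIV. Poly_Mapping.lookup (a' + b') v = Poly_Mapping.lookup (a + b) v) \<longrightarrow>
           (\<forall>v\<in>UNIV. Poly_Mapping.lookup a' v = Poly_Mapping.lookup a v \<and>
                   Poly_Mapping.lookup b' v = Poly_Mapping.lookup b v)"
    by blast
  show thesis
  proof (rule that[OF \<open>a \<in> A\<close> \<open>b \<in> B\<close>])
    fix a' b' assume "a' \<in> A" "b' \<in> B" "a' + b' = a + b"
    with u show "a' = a \<and> b' = b" by (simp add: poly_mapping_eq_iff fun_eq_iff)
  qed
qed

text \<open>A nonzero convolution term at \<open>a + b\<close> other than the expected one would be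
  a second decomposition of \<open>a + b\<close> within the supports.\<close>

lemma lookup_mult_unique:
  fixes f g :: "'a::monoid_add \<Rightarrow>\<^sub>0 'b::semiring_0"
  assumes "\<And>a' b'. a' \<in> Poly_Mapping.keys f \<Longrightarrow> b' \<in> Poly_Mapping.keys g \<Longrightarrow> a' + b' = a + b \<Longrightarrow> a' = a \<and> b' = b"
  shows "Poly_Mapping.lookup (f * g) (a + b) = Poly_Mapping.lookup f a * Poly_Mapping.lookup g b"
proof -
  let ?l = Poly_Mapping.lookup
  have "?l (f * g) (a + b) = (\<Sum>(a', b'). ?l f a' * ?l g b' when a + b = a' + b')"
    by (simp add: times_poly_mapping.rep_eq prod_fun_unfold_prod)
  also have "\<dots> = (\<Sum>x. (?l f a * ?l g b) when x = (a, b))"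
  proof (intro Sum_any.cong)
    fix x :: "'a \<times> 'a"
    obtain a' b' where x: "x = (a', b')" by (cases x)
    have "?l f a' * ?l g b' = 0" if "a + b = a' + b'" "x \<noteq> (a, b)"
    proof (rule ccontr)
      assume "?l f a' * ?l g b' \<noteq> 0"
      then have "a' \<in> Poly_Mapping.keys f" "b' \<in> Poly_Mapping.keys g"
        by (auto simp: in_keys_iff)
      with assms[of a' b'] that x show False by simp
    qed
    then show "(case x of (a', b') \<Rightarrow> ?l f a' * ?l g b' when a + b = a' + b')
        = (?l f a * ?l g b when x = (a, b))"
      using x by (auto simp: when_def)
  qed
  also have "\<dots> = ?l f a * ?l g b" by simp
  finally show ?thesis .
qed

text \<open>The ideal generated by the variables in \<open>V\<close>, encoded through supports so
  that membership is a test on each monomial separately.\<close>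

definition var_ideal :: "'v set \<Rightarrow> ('v, 'k::field) mpol set" where
  "var_ideal V = {f. \<forall>m \<in> Poly_Mapping.keys f. Poly_Mapping.keys m \<inter> V \<noteq> {}}"

lemma keys_add_nat: "Poly_Mapping.keys (a + b) = Poly_Mapping.keys a \<union> Poly_Mapping.keys b"
  for a b :: "'v \<Rightarrow>\<^sub>0 nat"
  by (auto simp: in_keys_iff lookup_add)

lemma keys_mpol_var [simp]: "Poly_Mapping.keys (mpol_var v :: ('v, 'k::field) mpol) = {Poly_Mapping.single v 1}"
  by (simp add: mpol_var_def)

lemma mpol_var_in_var_ideal_iff: "(mpol_var v :: ('v, 'k::field) mpol) \<in> var_ideal V \<longleftrightarrow> v \<in> V"
  by (simp add: var_ideal_def)

lemma var_ideal_mono: "V \<subseteq> W \<Longrightarrow> var_ideal V \<subseteq> var_ideal W"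
  by (force simp: var_ideal_def)

lemma var_ideal_strict_mono: "V \<subset> W \<Longrightarrow> var_ideal V \<subset> (var_ideal W :: ('v, 'k::field) mpol set)"
  using var_ideal_mono[of V W] mpol_var_in_var_ideal_iff[where 'k='k]
  by (metis psubsetE psubsetI subset_eq)

text \<open>If neither factor is in the ideal, both have monomials avoiding \<open>V\<close>. Among
  the sums of such monomials one arises in a unique way, so it cannot cancel in the product, and it
  avoids \<open>V\<close> too.\<close>

lemma primeideal_var_ideal:
  "primeideal (var_ideal V :: ('v::finite, 'k::field) mpol set) mpol_ring"
  unfolding primeideal_type_algebra_iff
proof (intro conjI ballI allI impI)
  let ?keys = "Poly_Mapping.keys"
  let ?I = "var_ideal V :: ('v::finite, 'k::field) mpol set"
  fix f g :: "('v, 'k) mpol"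
  show "f + g \<in> ?I" if "f \<in> ?I" "g \<in> ?I"
    using that keys_add[of f g] by (auto simp: var_ideal_def)
  show "f * g \<in> ?I" if "g \<in> ?I"
    unfolding var_ideal_def
  proof (intro CollectI ballI)
    fix m assume "m \<in> ?keys (f * g)"
    then obtain a b where "m = a + b" "b \<in> ?keys g" using keys_mult[of f g] by auto
    then show "?keys m \<inter> V \<noteq> {}" using that by (auto simp: var_ideal_def keys_add_nat)
  qed
  assume fg: "f * g \<in> ?I"
  show "f \<in> ?I \<or> g \<in> ?I"
  proof (rule ccontr)
    assume "\<not> (f \<in> ?I \<or> g \<in> ?I)"
    define free where "free h = {m \<in> ?keys h. ?keys m \<inter> V = {}}" for h :: "('v, 'k) mpol"
    have "free f \<noteq> {}" "free g \<noteq> {}" "finite (free f)" "finite (free g)"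
      using \<open>\<not> (f \<in> ?I \<or> g \<in> ?I)\<close> by (auto simp: var_ideal_def free_def)
    then obtain a b where ab: "a \<in> free f" "b \<in> free g"
      and u: "\<And>a' b'. a' \<in> free f \<Longrightarrow> b' \<in> free g \<Longrightarrow> a' + b' = a + b \<Longrightarrow> a' = a \<and> b' = b"
      using unique_sum[of "free f" "free g"] by metis
    have V: "?keys (a + b) \<inter> V = {}" using ab by (auto simp: free_def keys_add_nat)
    have "Poly_Mapping.lookup (f * g) (a + b) = Poly_Mapping.lookup f a * Poly_Mapping.lookup g b"
    proof (rule lookup_mult_unique)
      \<comment> \<open>Summands of a monomial avoiding \<open>V\<close> avoid \<open>V\<close> as
        well, so uniqueness among the free parts extends to the full supports.\<close>
      fix a' b' assume *: "a' \<in> ?keys f" "b' \<in> ?keys g" "a' + b' = a + b"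
      then have "?keys a' \<inter> V = {}" "?keys b' \<inter> V = {}"
        using V keys_add_nat[of a' b'] by auto
      then show "a' = a \<and> b' = b" using * u by (auto simp: free_def)
    qed
    also have "\<dots> \<noteq> 0" using ab by (auto simp: free_def in_keys_iff)
    finally have "a + b \<in> ?keys (f * g)" by (simp add: in_keys_iff)
    with fg V show False by (auto simp: var_ideal_def)
  qed
qed (auto simp: var_ideal_def)

section \<open>Monomials and variables in an ideal\<close>

lemma mpol_eq_sum_monomials:
  assumes "finite M" "Poly_Mapping.keys f \<subseteq> M"
  shows "f = (\<Sum>m\<in>M. Poly_Mapping.single m (Poly_Mapping.lookup f m))"
proof (rule poly_mapping_eqI)
  fix k
  have "(\<Sum>m\<in>M. Poly_Mapping.lookup f m when m = k) = (if k \<in> M then Poly_Mapping.lookup f k else 0)"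
    using assms(1) by (simp add: when_def sum.delta cong: if_cong)
  also have "\<dots> = Poly_Mapping.lookup f k" using assms(2) by (auto simp: in_keys_iff)
  finally show "Poly_Mapping.lookup f k =
      Poly_Mapping.lookup (\<Sum>m\<in>M. Poly_Mapping.single m (Poly_Mapping.lookup f m)) k"
    by (simp add: lookup_sum lookup_single)
qed

text \<open>The squarefree monomial on \<open>W\<close> divides every monomial whose support
  contains \<open>W\<close>; its variables are split off one at a time.\<close>

lemma monomial_mem_ideal:
  assumes "ideal I mpol_ring" "finite W" "W \<subseteq> Poly_Mapping.keys m"
    "(\<Prod>v\<in>W. mpol_var v) \<in> I"
  shows "Poly_Mapping.single m (c :: 'k::field) \<in> I"
proof -
  have "\<exists>m'. Poly_Mapping.single m c = Poly_Mapping.single m' c * (\<Prod>v\<in>W. mpol_var v)"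
    using assms(2,3)
  proof (induction W arbitrary: m rule: finite_induct)
    case (insert v W)
    let ?m = "m - Poly_Mapping.single v 1"
    have m: "m = ?m + Poly_Mapping.single v 1"
      using insert.prems by (intro poly_mapping_eqI)
        (auto simp: lookup_add lookup_minus lookup_single in_keys_iff when_def)
    \<comment> \<open>Lowering the exponent of \<open>v\<close>, possibly to zero, leaves the
      support on \<open>W\<close> intact because \<open>v\<close> is not in
      \<open>W\<close>.\<close>
    have "W \<subseteq> Poly_Mapping.keys ?m"
      using insert by (auto simp: in_keys_iff lookup_minus lookup_single when_def)
    then obtain m' where m': "Poly_Mapping.single ?m c = Poly_Mapping.single m' c * (\<Prod>v\<in>W. mpol_var v)"
      using insert.IH by blast
    have "Poly_Mapping.single m c = Poly_Mapping.single ?m c * mpol_var v"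
      by (subst m) (simp add: mpol_var_def mult_single)
    then show ?case
      using insert.hyps m' by (intro exI[of _ m']) (simp add: mult.assoc mult.commute[of "mpol_var v"])
  qed auto
  then show ?thesis using assms ideal_mult_closed by metis
qed

lemma var_ideal_subset_ideal:
  fixes Q :: "('v, 'k::field) mpol set"
  assumes Q: "ideal Q mpol_ring" and V: "\<And>v. v \<in> V \<Longrightarrow> mpol_var v \<in> Q"
  shows "var_ideal V \<subseteq> Q"
proof
  fix f :: "('v, 'k) mpol" assume f: "f \<in> var_ideal V"
  have "Poly_Mapping.single m (Poly_Mapping.lookup f m) \<in> Q" if m: "m \<in> Poly_Mapping.keys f" for m
  proof -
    from f m obtain v where v: "v \<in> Poly_Mapping.keys m" "v \<in> V" by (auto simp: var_ideal_def)
    show ?thesis by (rule monomial_mem_ideal[OF Q, of "{v}"]) (use v V in auto)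
  qed
  then show "f \<in> Q"
    by (subst mpol_eq_sum_monomials[of "Poly_Mapping.keys f"]) (auto intro: ideal_sum_closed[OF Q])
qed

subsection \<open>The dimension of a polynomial ring\<close>

lemma lookup_mpol_const_mult [simp]:
  "Poly_Mapping.lookup (mpol_const c * f) m = c * Poly_Mapping.lookup f m"
  by (simp add: mpol_const_def map.rep_eq when_def flip: mult_map_scale_conv_mult)

lemma mpol_const_hom [simp]:
  "mpol_const 0 = 0" "mpol_const 1 = 1"
  "mpol_const (a + b) = mpol_const a + mpol_const b"
  "mpol_const (a * b) = mpol_const a * mpol_const b"
  by (simp_all add: mpol_const_def single_add mult_single)

section \<open>Counting monomials with bounded exponents\<close>

definition exp_bounded :: "nat \<Rightarrow> ('v, 'k::field) mpol \<Rightarrow> bool" where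
  "exp_bounded D f \<longleftrightarrow> (\<forall>m\<in>Poly_Mapping.keys f. \<forall>v. Poly_Mapping.lookup m v \<le> D)"

lemma exp_bounded_one: "exp_bounded D 1"
  by (auto simp: exp_bounded_def)

lemma exp_bounded_mult: "exp_bounded D f \<Longrightarrow> exp_bounded E g \<Longrightarrow> exp_bounded (D + E) (f * g)"
  using keys_mult[of f g] by (fastforce simp: exp_bounded_def lookup_add intro: add_mono)

lemma exp_bounded_power: "exp_bounded D f \<Longrightarrow> exp_bounded (D * n) (f ^ n)"
  by (induction n) (auto simp: exp_bounded_one intro: exp_bounded_mult)

lemma exp_bounded_mono: "exp_bounded D f \<Longrightarrow> D \<le> E \<Longrightarrow> exp_bounded E f"
  by (meson exp_bounded_def le_trans)

lemma exp_bounded_exists: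
  fixes f :: "('v::finite, 'k::field) mpol"
  obtains D where "exp_bounded D f"
proof
  let ?A = "(\<lambda>(m, v). Poly_Mapping.lookup m v) ` (Poly_Mapping.keys f \<times> UNIV)"
  show "exp_bounded (Max ?A) f"
    unfolding exp_bounded_def by (intro ballI allI Max_ge) auto
qed

lemma exp_bounded_common:
  fixes gs :: "('v::finite, 'k::field) mpol list"
  obtains D where "\<And>g. g \<in> set gs \<Longrightarrow> exp_bounded D g"
proof -
  have "\<exists>D. \<forall>g\<in>set gs. exp_bounded D g"
  proof (induction gs)
    case (Cons g gs)
    then obtain D where D: "\<forall>g\<in>set gs. exp_bounded D g" by blast
    obtain E where "exp_bounded E g" by (rule exp_bounded_exists)
    with D show ?case
      by (intro exI[of _ "max D E"]) (auto intro: exp_bounded_mono)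
  qed simp
  with that show thesis by blast
qed

text \<open>Bounding every exponent, rather than the total degree, puts the exponent vectors in a
  box of functions.\<close>

lemma card_bounded_exponents:
  shows "finite {m :: 'v::finite \<Rightarrow>\<^sub>0 nat. \<forall>v. Poly_Mapping.lookup m v \<le> D}"
    and "card {m :: 'v \<Rightarrow>\<^sub>0 nat. \<forall>v. Poly_Mapping.lookup m v \<le> D} \<le> (D + 1) ^ CARD('v)"
proof -
  let ?M = "{m :: 'v \<Rightarrow>\<^sub>0 nat. \<forall>v. Poly_Mapping.lookup m v \<le> D}"
  let ?F = "PiE (UNIV :: 'v set) (\<lambda>_. {..D})"
  have inj: "inj_on Poly_Mapping.lookup ?M"
    by (rule inj_onI) (simp add: lookup_inject)
  have sub: "Poly_Mapping.lookup ` ?M \<subseteq> ?F" by (auto simp: PiE_def)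
  have fin: "finite ?F" by (intro finite_PiE) auto
  show "finite ?M" using finite_imageD[OF finite_subset[OF sub fin] inj] .
  have "card ?M = card (Poly_Mapping.lookup ` ?M)" by (simp add: card_image[OF inj])
  also have "\<dots> \<le> card ?F" by (rule card_mono[OF fin sub])
  also have "\<dots> = (D + 1) ^ CARD('v)" by (simp add: card_PiE)
  finally show "card ?M \<le> (D + 1) ^ CARD('v)" .
qed

interpretation mpol: vector_space "\<lambda>c f. mpol_const c * (f :: ('v, 'k::field) mpol)"
  by unfold_locales (simp_all add: algebra_simps)

text \<open>The family is independent inside the span of the monomials in the box of side
  \<open>D + 1\<close>, so the size of the box bounds it.\<close>

lemma card_independent_family_le:
  fixes b :: "'i \<Rightarrow> ('v::finite, 'k::field) mpol"
  assumes fin: "finite A" and bound: "\<And>a. a \<in> A \<Longrightarrow> exp_bounded D (b a)"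
    and indep: "\<And>c. (\<Sum>a\<in>A. mpol_const (c a) * b a) = 0 \<Longrightarrow> \<forall>a\<in>A. c a = 0"
  shows "card A \<le> (D + 1) ^ CARD('v)"
proof -
  let ?M = "{m :: 'v \<Rightarrow>\<^sub>0 nat. \<forall>v. Poly_Mapping.lookup m v \<le> D}"
  let ?X = "(\<lambda>m. Poly_Mapping.single m 1 :: ('v, 'k) mpol) ` ?M"
  have inj: "inj_on b A"
  proof (rule inj_onI, rule ccontr)
    fix x y assume xy: "x \<in> A" "y \<in> A" "b x = b y" "x \<noteq> y"
    \<comment> \<open>A repeated member would give the nontrivial relation
      \<open>b x - b y = 0\<close>.\<close>
    define c :: "'i \<Rightarrow> 'k" where "c a = (if a = x then 1 else 0) + (if a = y then -1 else 0)" for a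
    have neg: "mpol_const (- 1 :: 'k) = (- 1 :: ('v, 'k) mpol)"
      by (simp add: mpol_const_def single_uminus)
    have "(\<Sum>a\<in>A. mpol_const (c a) * b a) =
        (\<Sum>a\<in>A. if a = x then b a else 0) + (\<Sum>a\<in>A. if a = y then - b a else 0)"
      unfolding sum.distrib[symmetric] by (intro sum.cong) (auto simp: c_def neg)
    also have "\<dots> = 0" using xy fin by (simp add: sum.delta)
    finally have "c x = 0" using indep xy by blast
    then show False using xy by (simp add: c_def)
  qed
  have "mpol.independent (b ` A)"
    unfolding mpol.dependent_finite[OF finite_imageI[OF fin]]
  proof
    assume "\<exists>u. (\<exists>v\<in>b ` A. u v \<noteq> 0) \<and> (\<Sum>v\<in>b ` A. mpol_const (u v) * v) = 0"
    then obtain u where u: "\<exists>a\<in>A. u (b a) \<noteq> 0" "(\<Sum>v\<in>b ` A. mpol_const (u v) * v) = 0" by blast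
    then have "(\<Sum>a\<in>A. mpol_const (u (b a)) * b a) = 0" by (simp add: sum.reindex[OF inj])
    from indep[OF this] u(1) show False by blast
  qed
  moreover have "b ` A \<subseteq> mpol.span ?X"
  proof clarify
    fix a assume "a \<in> A"
    then have "Poly_Mapping.keys (b a) \<subseteq> ?M" using bound by (auto simp: exp_bounded_def)
    from mpol_eq_sum_monomials[OF card_bounded_exponents(1) this]
    have *: "b a = (\<Sum>m\<in>?M. mpol_const (Poly_Mapping.lookup (b a) m) * Poly_Mapping.single m 1)"
      by (simp add: mpol_const_def mult_single)
    show "b a \<in> mpol.span ?X"
      by (subst *) (intro mpol.span_sum mpol.span_scale mpol.span_base imageI)
  qed
  ultimately have "card (b ` A) \<le> card ?X"
    using mpol.independent_span_bound[of ?X "b ` A"] card_bounded_exponents(1)[of D, where 'v='v]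
    by blast
  also have "\<dots> \<le> card ?M" by (rule card_image_le[OF card_bounded_exponents(1)])
  also have "\<dots> \<le> (D + 1) ^ CARD('v)" by (rule card_bounded_exponents(2))
  finally show ?thesis by (simp add: card_image[OF inj])
qed

section \<open>Power products along a chain of primes\<close>

definition power_product :: "'a::comm_monoid_mult list \<Rightarrow> nat list \<Rightarrow> 'a" where
  "power_product gs es = prod_list (map2 (^) gs es)"

lemma power_product_simps [simp]:
  "power_product [] es = 1" "power_product (g # gs) (e # es) = g ^ e * power_product gs es"
  by (simp_all add: power_product_def)

lemma exp_bounded_power_product:
  assumes "\<And>g. g \<in> set gs \<Longrightarrow> exp_bounded D g" "length es = length gs" "set es \<subseteq> {..<J}"
  shows "exp_bounded (length gs * (D * J)) (power_product gs es)"
  using assms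
proof (induction gs arbitrary: es)
  case (Cons g gs)
  then obtain e es' where es: "es = e # es'" by (cases es) auto
  have "exp_bounded (D * J) (g ^ e)"
    by (rule exp_bounded_mono[OF exp_bounded_power]) (use Cons.prems es in auto)
  then show ?case using Cons es by (auto intro!: exp_bounded_mult)
qed (simp add: exp_bounded_one)

text \<open>Read the sum as a polynomial in \<open>g\<close>. Modulo \<open>Q\<close> only
  \<open>T 0\<close> remains, so it is zero; then \<open>g\<close> can be cancelled modulo the prime
  \<open>P\<close>, and the argument repeats with shifted coefficients.\<close>

lemma prime_step_independent:
  fixes P Q :: "'a::comm_ring_1 set"
  assumes P: "primeideal P ring_of_type_algebra" and Q: "primeideal Q ring_of_type_algebra"
    and "P \<subseteq> Q" "g \<in> Q" "g \<notin> P"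
  shows "(\<And>j. T j \<in> Q \<Longrightarrow> T j = 0) \<Longrightarrow> (\<Sum>j<J. g ^ j * T j) \<in> P \<Longrightarrow> j < J \<Longrightarrow> T j = 0"
proof (induction J arbitrary: T j)
  case (Suc J)
  note P = P[unfolded primeideal_type_algebra_iff] and Q = Q[unfolded primeideal_type_algebra_iff]
  let ?S = "\<Sum>j<J. g ^ j * T (Suc j)"
  have eq: "(\<Sum>j<Suc J. g ^ j * T j) = T 0 + g * ?S"
    unfolding sum.lessThan_Suc_shift by (simp add: sum_distrib_left mult.assoc)
  have S: "T 0 + g * ?S \<in> P" using Suc.prems(2) unfolding eq .
  \<comment> \<open>Adding this multiple of \<open>g\<close> to the given element of
    \<open>P\<close> isolates \<open>T 0\<close> inside \<open>Q\<close>.\<close>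
  have "(- ?S) * g \<in> Q" using Q \<open>g \<in> Q\<close> by blast
  then have "T 0 + g * ?S + (- ?S) * g \<in> Q" using Q S \<open>P \<subseteq> Q\<close> by blast
  then have "T 0 \<in> Q" by (simp add: mult.commute)
  then have T0: "T 0 = 0" by (rule Suc.prems(1))
  then have "?S \<in> P" using S P \<open>g \<notin> P\<close> by auto
  then have "T (Suc i) = 0" if "i < J" for i
    using Suc.IH[of "\<lambda>j. T (Suc j)" i] Suc.prems(1) that by blast
  then show ?case using T0 Suc.prems(3) by (cases j) auto
qed simp

text \<open>The definition compares all pairs; by transitivity, comparing with the next prime
  suffices, which is the form that inductions on chains use.\<close>

lemma prime_chain_Cons:
  "prime_chain R (P # ps) \<longleftrightarrow> primeideal P R \<and> (ps = [] \<or> P \<subset> hd ps \<and> prime_chain R ps)"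
proof (cases ps)
  case (Cons Q qs)
  have "sorted_wrt (\<subset>) (P # Q # qs) \<longleftrightarrow> P \<subset> Q \<and> sorted_wrt (\<subset>) (Q # qs)"
    by (rule sorted_wrt2) (auto simp: transp_def)
  then show ?thesis using Cons by (auto simp: prime_chain_def simp del: sorted_wrt.simps)
qed (simp add: prime_chain_def)

text \<open>One element is chosen from each strict inclusion, and independence modulo the smallest
  prime is propagated downwards from the top of the chain.\<close>

lemma prime_chain_independent:
  fixes ps :: "('v, 'k::field) mpol set list"
  assumes "prime_chain mpol_ring ps"
  shows "\<exists>gs. length ps = Suc (length gs) \<and>
    (\<forall>J c. (\<Sum>es\<in>{es. set es \<subseteq> {..<J} \<and> length es = length gs}.
              mpol_const (c es) * power_product gs es) \<in> hd ps \<longrightarrow>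
           (\<forall>es. set es \<subseteq> {..<J} \<and> length es = length gs \<longrightarrow> c es = 0))"
  using assms
proof (induction ps)
  case (Cons P ps)
  then have P: "primeideal P mpol_ring" by (simp add: prime_chain_Cons)
  note P' = P[unfolded primeideal_type_algebra_iff]
  show ?case
  proof (cases ps)
    case Nil
    \<comment> \<open>For a single prime the only power product is \<open>1\<close>, and a nonzero
      constant is a unit, hence outside \<open>P\<close>.\<close>
    have "c = 0" if "mpol_const c \<in> P" for c
    proof (rule ccontr)
      assume "c \<noteq> 0"
      have "mpol_const (inverse c) * mpol_const c \<in> P" using P' that by blast
      then have "mpol_const (inverse c * c) \<in> P" by (simp only: mpol_const_hom)
      with \<open>c \<noteq> 0\<close> P' show False by simp
    qed
    moreover have "{es. set es \<subseteq> {..<J} \<and> es = []} = {[]}" for J :: nat by auto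
    ultimately show ?thesis using Nil by (intro exI[of _ "[]"]) auto
  next
    case (Cons Q qs)
    with Cons.prems have PQ: "P \<subset> Q" and chain: "prime_chain mpol_ring ps"
      by (auto simp: prime_chain_Cons)
    then have Q: "primeideal Q mpol_ring" using Cons by (simp add: prime_chain_Cons)
    note Q' = Q[unfolded primeideal_type_algebra_iff]
    obtain g where g: "g \<in> Q" "g \<notin> P" using PQ by blast
    define L where "L J k = {es :: nat list. set es \<subseteq> {..<J} \<and> length es = k}" for J k
    from Cons.IH[OF chain] Cons obtain gs where len: "length ps = Suc (length gs)"
      and gs: "\<And>J c es. (\<Sum>es\<in>L J (length gs). mpol_const (c es) * power_product gs es) \<in> Q \<Longrightarrow>
         es \<in> L J (length gs) \<Longrightarrow> c es = 0"
      unfolding L_def by auto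
    have "c es = 0" if sum: "(\<Sum>es\<in>L J (Suc (length gs)). mpol_const (c es) * power_product (g # gs) es) \<in> P"
      and es: "es \<in> L J (Suc (length gs))" for J c es
    proof -
      \<comment> \<open>\<open>T j\<close> collects the terms in which \<open>g\<close> has exponent
        \<open>j\<close>. It involves only the elements of the shorter chain, so the induction
        hypothesis makes its coefficients vanish as soon as it lies in \<open>Q\<close>.\<close>
      define T where
        "T j = (\<Sum>es\<in>L J (length gs). mpol_const (c (j # es)) * power_product gs es)" for j
      have "(\<Sum>es\<in>L J (Suc (length gs)). mpol_const (c es) * power_product (g # gs) es) =
        (\<Sum>(j, es)\<in>{..<J} \<times> L J (length gs). mpol_const (c (j # es)) * (g ^ j * power_product gs es))"
        by (rule sum.reindex_bij_witness[of _ "\<lambda>(j, es). j # es" "\<lambda>es. (hd es, tl es)"])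
          (auto simp: L_def length_Suc_conv)
      also have "\<dots> = (\<Sum>j<J. g ^ j * T j)"
        by (simp add: sum.cartesian_product[symmetric] T_def sum_distrib_left algebra_simps)
      finally have S: "(\<Sum>j<J. g ^ j * T j) \<in> P" using sum by simp
      have T: "T j = 0" if "T j \<in> Q" for j
        using gs[of "\<lambda>es. c (j # es)" J] that by (auto simp: T_def intro!: sum.neutral)
      obtain j es' where j: "es = j # es'" "j < J" "es' \<in> L J (length gs)"
        using es by (auto simp: L_def length_Suc_conv)
      have "T j = 0"
        using prime_step_independent[OF P Q _ g T S j(2)] PQ by blast
      then have "T j \<in> Q" using Q' by simp
      then show ?thesis using gs[of "\<lambda>es. c (j # es)" J es'] j by (simp add: T_def)
    qed
    then show ?thesis using len by (intro exI[of _ "g # gs"]) (auto simp: L_def)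
  qed
qed (simp add: prime_chain_def)

text \<open>Since \<open>0\<close> lies in the smallest prime, independence modulo it gives plain
  independence of \<open>J ^ k\<close> power products, whose exponents grow only linearly in
  \<open>J\<close>.\<close>

lemma prime_chain_length_le:
  fixes ps :: "('v::finite, 'k::field) mpol set list"
  assumes chain: "prime_chain mpol_ring ps"
  shows "length ps \<le> CARD('v) + 1"
proof -
  from prime_chain_independent[OF chain] obtain gs where len: "length ps = Suc (length gs)"
    and gs: "\<And>J c es. (\<Sum>es\<in>{es. set es \<subseteq> {..<J} \<and> length es = length gs}.
              mpol_const (c es) * power_product gs es) \<in> hd ps \<Longrightarrow>
           set es \<subseteq> {..<J} \<and> length es = length gs \<Longrightarrow> c es = 0"
    by blast
  have "primeideal (hd ps) mpol_ring" using chain by (cases ps) (auto simp: prime_chain_def)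
  then have zero: "0 \<in> hd ps" by (simp add: primeideal_type_algebra_iff)
  obtain D where D: "\<And>g. g \<in> set gs \<Longrightarrow> exp_bounded D g" using exp_bounded_common[of gs] by blast
  define k where "k = length gs"
  define m where "m = CARD('v)"
  \<comment> \<open>For \<open>J \<ge> 1\<close> the box has at most \<open>C * J ^ m\<close>
    monomials. Taking \<open>J\<close> just above \<open>C\<close> yields
    \<open>J ^ k < J ^ (m + 1)\<close> and therefore \<open>k \<le> m\<close>.\<close>
  define C where "C = (k * D + 1) ^ m"
  define J where "J = C + 1"
  define L where "L = {es. set es \<subseteq> {..<J} \<and> length es = k}"
  have "card L \<le> (k * (D * J) + 1) ^ CARD('v)"
  proof (rule card_independent_family_le[where b = "power_product gs"])
    show "finite L" unfolding L_def by (rule finite_lists_length_eq) simp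
    show "exp_bounded (k * (D * J)) (power_product gs es)" if "es \<in> L" for es
      using that D unfolding k_def L_def by (intro exp_bounded_power_product) auto
    show "\<forall>es\<in>L. c es = 0" if "(\<Sum>es\<in>L. mpol_const (c es) * power_product gs es) = 0" for c
      using gs[of c J] that zero unfolding L_def k_def by auto
  qed
  moreover have "card L = J ^ k" unfolding L_def by (simp add: card_lists_length_eq)
  ultimately have "J ^ k \<le> (k * (D * J) + 1) ^ m" by (simp add: m_def)
  also have "\<dots> \<le> ((k * D + 1) * J) ^ m" by (rule power_mono) (auto simp: J_def algebra_simps)
  also have "\<dots> = C * J ^ m" by (simp only: C_def power_mult_distrib)
  also have "\<dots> < J * J ^ m" by (simp add: J_def)
  finally have "J ^ k < J ^ Suc m" by simp
  then have "\<not> J ^ Suc m \<le> J ^ k" by simp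
  then have "k < Suc m" using power_increasing[of "Suc m" k J] by (fastforce simp: J_def)
  then show ?thesis using len by (simp add: k_def m_def)
qed

subsection \<open>Chains of prime ideals\<close>

lemma prime_chain_not_Nil: "prime_chain R ps \<Longrightarrow> ps \<noteq> []"
  by (simp add: prime_chain_def)

text \<open>The common prime is kept once, whence \<open>tl qs\<close>; the lengths of the chains,
  counted in inclusions, add up.\<close>

lemma prime_chain_join:
  assumes "prime_chain R ps" "prime_chain R qs" "last ps = hd qs"
  shows "prime_chain R (ps @ tl qs)"
  using assms
proof (induction ps)
  case (Cons P ps)
  show ?case
  proof (cases ps)
    case Nil
    then have "ps @ tl qs = tl qs" "P # tl qs = qs"
      using Cons.prems by (auto simp: prime_chain_def)
    with Cons.prems show ?thesis by simp
  next
    case (Cons Q ps')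
    with Cons.prems Cons.IH show ?thesis by (auto simp: prime_chain_Cons)
  qed
qed (simp add: prime_chain_def)

lemma prime_chain_snoc:
  assumes "prime_chain R ps" "last ps \<subset> Q" "primeideal Q R"
  shows "prime_chain R (ps @ [Q])"
proof -
  have "primeideal (last ps) R" using assms(1) by (auto simp: prime_chain_def)
  then have "prime_chain R [last ps, Q]" using assms by (simp add: prime_chain_def)
  from prime_chain_join[OF assms(1) this] show ?thesis by simp
qed

text \<open>The variables of \<open>W\<close> are adjoined one at a time.\<close>

lemma var_ideal_chain:
  fixes V W :: "'v::finite set"
  assumes "V \<inter> W = {}"
  shows "\<exists>ps. prime_chain (mpol_ring :: ('v, 'k::field) mpol ring) ps \<and>
    hd ps = var_ideal V \<and> last ps = var_ideal (V \<union> W) \<and> length ps = card W + 1"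
proof -
  have "finite W" by simp
  then show ?thesis using assms
  proof (induction W arbitrary: V rule: finite_induct)
    case empty
    then show ?case
      by (intro exI[of _ "[var_ideal V]"]) (simp add: prime_chain_def primeideal_var_ideal)
  next
    case (insert v W)
    then have "insert v V \<inter> W = {}" by auto
    from insert.IH[OF this] obtain ps
      where ps: "prime_chain (mpol_ring :: ('v, 'k) mpol ring) ps" "hd ps = var_ideal (insert v V)"
        "last ps = var_ideal (insert v V \<union> W)" "length ps = card W + 1"
      by blast
    have "var_ideal V \<subset> (var_ideal (insert v V) :: ('v, 'k) mpol set)"
      using insert.prems by (intro var_ideal_strict_mono) auto
    with ps show ?case using insert.hyps
      by (intro exI[of _ "var_ideal V # ps"])
        (auto simp: prime_chain_Cons primeideal_var_ideal prime_chain_not_Nil)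
  qed
qed

text \<open>A chain ending at this prime continues up to the ideal of all variables in
  \<open>card (- V)\<close> further steps, and the joined chain obeys the global length
  bound.\<close>

lemma prime_height_var_ideal_le:
  fixes V :: "'v::finite set"
  shows "prime_height mpol_ring (var_ideal V :: ('v, 'k::field) mpol set) \<le> enat (card V)"
  unfolding prime_height_def
proof (rule SUP_least)
  fix ps :: "('v, 'k) mpol set list"
  assume "ps \<in> {ps. prime_chain mpol_ring ps \<and> last ps = var_ideal V}"
  then have ps: "prime_chain mpol_ring ps" "last ps = var_ideal V" by auto
  obtain qs where qs: "prime_chain mpol_ring qs" "hd qs = (var_ideal V :: ('v, 'k) mpol set)"
    "length qs = card (- V) + 1"
    using var_ideal_chain[of V "- V", where 'k='k] by auto
  have "length (ps @ tl qs) \<le> CARD('v) + 1"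
    using ps qs by (intro prime_chain_length_le prime_chain_join) auto
  moreover have "card (- V) + card V = CARD('v)"
    by (simp add: Compl_eq_Diff_UNIV card_Diff_subset card_mono)
  ultimately have "length ps - 1 \<le> card V" using qs(3) by simp
  then show "enat (length ps - 1) \<le> enat (card V)" by simp
qed

text \<open>The chain climbs from the zero ideal \<open>var_ideal {}\<close> to
  \<open>var_ideal V\<close>; \<open>Q\<close> is appended when it is strictly larger.\<close>

lemma prime_height_ge_var_ideal:
  fixes Q :: "('v::finite, 'k::field) mpol set"
  assumes Q: "primeideal Q mpol_ring" and sub: "var_ideal V \<subseteq> Q"
  shows "enat (card V) \<le> prime_height mpol_ring Q"
proof -
  obtain ps where ps: "prime_chain mpol_ring ps" "last ps = (var_ideal V :: ('v, 'k) mpol set)"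
    "length ps = card V + 1"
    using var_ideal_chain[of "{}" V, where 'k='k] by auto
  show ?thesis
  proof (cases "Q = var_ideal V")
    case True
    with ps have "enat (length ps - 1) \<le> prime_height mpol_ring Q"
      unfolding prime_height_def by (intro SUP_upper) auto
    with ps show ?thesis by simp
  next
    case False
    then have "prime_chain mpol_ring (ps @ [Q])"
      using ps sub Q by (intro prime_chain_snoc) auto
    then have "enat (length (ps @ [Q]) - 1) \<le> prime_height mpol_ring Q"
      unfolding prime_height_def by (intro SUP_upper) auto
    with ps show ?thesis by (simp add: order_trans[of "enat (card V)" "enat (Suc (card V))"])
  qed
qed

text \<open>A chain from zero to \<open>var_ideal V\<close> is put in front. Strictness requires
  separating the case where \<open>hd ps\<close> is \<open>var_ideal V\<close> itself.\<close>

lemma prime_chain_above_var_ideal_length_le: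
  fixes ps :: "('v::finite, 'k::field) mpol set list"
  assumes chain: "prime_chain mpol_ring ps" and sub: "var_ideal V \<subseteq> hd ps"
  shows "length ps - 1 \<le> CARD('v) - card V"
proof -
  obtain qs where qs: "prime_chain mpol_ring qs" "last qs = (var_ideal V :: ('v, 'k) mpol set)"
    "length qs = card V + 1"
    using var_ideal_chain[of "{}" V, where 'k='k] by auto
  have hd: "primeideal (hd ps) mpol_ring"
    using chain by (cases ps) (auto simp: prime_chain_def)
  show ?thesis
  proof (cases "hd ps = var_ideal V")
    case True
    then have "prime_chain mpol_ring (qs @ tl ps)" using qs chain by (intro prime_chain_join) auto
    from prime_chain_length_le[OF this] qs show ?thesis by simp
  next
    case False
    then have "prime_chain mpol_ring (qs @ [hd ps])"
      using qs sub hd by (intro prime_chain_snoc) auto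
    then have "prime_chain mpol_ring ((qs @ [hd ps]) @ tl ps)"
      using chain by (intro prime_chain_join) auto
    from prime_chain_length_le[OF this] qs show ?thesis by simp
  qed
qed

subsection \<open>Prime ideals of a quotient ring\<close>

lemma (in ring) carrier_quot: "carrier (R Quot I) = (+>) I ` carrier R"
  by (simp only: FactRing_def A_RCOSETS_def' partial_object.simps UNION_singleton_eq_range)

text \<open>An ideal containing \<open>I\<close> is a union of cosets of \<open>I\<close>, so
  passing to the quotient loses no information about membership.\<close>

lemma (in cring) coset_mem_image_iff:
  assumes I: "ideal I R" and P: "ideal P R" and "I \<subseteq> P" and x: "x \<in> carrier R"
  shows "I +> x \<in> (+>) I ` P \<longleftrightarrow> x \<in> P"
proof
  interpret P: ideal P R by fact
  assume "I +> x \<in> (+>) I ` P"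
  then obtain y where y: "y \<in> P" "I +> x = I +> y" by auto
  then have "x \<ominus> y \<in> P"
    using quotient_eq_iff_same_a_r_cos[OF I x] P.a_Hcarr \<open>I \<subseteq> P\<close> by auto
  then have "(x \<ominus> y) \<oplus> y \<in> P" using y by simp
  moreover have "(x \<ominus> y) \<oplus> y = x" using x P.a_Hcarr[OF y(1)] by algebra
  ultimately show "x \<in> P" by simp
qed auto

lemma (in cring) primeideal_quot_image:
  assumes I: "ideal I R" and P: "primeideal P R" and sub: "I \<subseteq> P"
  shows "primeideal ((+>) I ` P) (R Quot I)"
proof -
  interpret I: ideal I R by fact
  interpret P: primeideal P R by fact
  note mem = coset_mem_image_iff[OF I P.ideal_axioms sub]
  show ?thesis
  proof (rule primeidealI)
    show "ideal ((+>) I ` P) (R Quot I)"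
      by (rule ring_ideal_imp_quot_ideal[OF I P.ideal_axioms])
    show "cring (R Quot I)" by (rule I.quotient_is_cring[OF is_cring])
    obtain x where x: "x \<in> carrier R" "x \<notin> P" using P.I_notcarr P.a_subset by blast
    have "I +> x \<in> carrier (R Quot I)" unfolding carrier_quot by (rule imageI[OF x(1)])
    moreover have "I +> x \<notin> (+>) I ` P" using mem[OF x(1)] x(2) by simp
    ultimately show "carrier (R Quot I) \<noteq> (+>) I ` P" by metis
    fix a b
    assume "a \<in> carrier (R Quot I)" "b \<in> carrier (R Quot I)"
      and ab: "a \<otimes>\<^bsub>R Quot I\<^esub> b \<in> (+>) I ` P"
    then obtain x y where xy: "x \<in> carrier R" "a = I +> x" "y \<in> carrier R" "b = I +> y"
      by (auto simp: carrier_quot)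
    then have "I +> (x \<otimes> y) \<in> (+>) I ` P"
      using ab by (simp add: FactRing_def I.rcoset_mult_add)
    then have "x \<in> P \<or> y \<in> P" using mem xy P.I_prime by simp
    then show "a \<in> (+>) I ` P \<or> b \<in> (+>) I ` P" using xy by auto
  qed
qed

lemma (in cring) prime_chain_quot_image:
  assumes I: "ideal I R" and chain: "prime_chain R ps" and sub: "\<And>P. P \<in> set ps \<Longrightarrow> I \<subseteq> P"
  shows "prime_chain (R Quot I) (map ((`) ((+>) I)) ps)"
proof -
  have "sorted_wrt (\<subset>) (map ((`) ((+>) I)) ps)"
  proof (rule sorted_wrt_map_mono)
    show "sorted_wrt (\<subset>) ps" using chain by (simp add: prime_chain_def)
    fix P Q assume *: "P \<in> set ps" "Q \<in> set ps" "P \<subset> Q"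
    then have P: "ideal P R" and Q: "ideal Q R"
      using chain by (auto simp: prime_chain_def primeideal_def)
    obtain x where x: "x \<in> Q" "x \<notin> P" using * by blast
    then have "I +> x \<notin> (+>) I ` P"
      using coset_mem_image_iff[OF I P sub] * ideal.Icarr[OF Q] by blast
    with x * show "(+>) I ` P \<subset> (+>) I ` Q" by blast
  qed
  then show ?thesis
    using chain primeideal_quot_image[OF I] sub by (auto simp: prime_chain_def)
qed

text \<open>Inclusions stay strict because every element of the quotient is a coset
  \<open>I +> x\<close>.\<close>

lemma (in cring) prime_chain_quot_vimage:
  assumes I: "ideal I R" and chain: "prime_chain (R Quot I) qs"
  defines "pre \<equiv> \<lambda>q. {r \<in> carrier R. I +> r \<in> q}"
  shows "prime_chain R (map pre qs)" and "\<And>q. q \<in> set qs \<Longrightarrow> I \<subseteq> pre q"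
proof -
  interpret I: ideal I R by fact
  interpret h: ring_hom_ring R "R Quot I" "(+>) I" by (rule I.rcos_ring_hom_ring)
  have prime: "primeideal q (R Quot I)" if "q \<in> set qs" for q
    using that chain by (simp add: prime_chain_def)
  have "sorted_wrt (\<subset>) (map pre qs)"
  proof (rule sorted_wrt_map_mono)
    show "sorted_wrt (\<subset>) qs" using chain by (simp add: prime_chain_def)
    fix p q assume *: "p \<in> set qs" "q \<in> set qs" "p \<subset> q"
    then obtain a where a: "a \<in> q" "a \<notin> p" by blast
    moreover have "q \<subseteq> carrier (R Quot I)"
      using ideal.Icarr[OF primeideal.axioms(1)[OF prime[OF *(2)]]] by blast
    ultimately obtain x where "x \<in> carrier R" "a = I +> x" by (auto simp: carrier_quot)
    then have "x \<in> pre q" "x \<notin> pre p" using a by (auto simp: pre_def)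
    moreover have "pre p \<subseteq> pre q" using * by (auto simp: pre_def)
    ultimately show "pre p \<subset> pre q" by blast
  qed
  moreover have "primeideal (pre q) R" if "q \<in> set qs" for q
    unfolding pre_def by (rule h.primeideal_vimage[OF is_cring prime[OF that]])
  ultimately show "prime_chain R (map pre qs)"
    using chain by (auto simp: prime_chain_def)
  show "I \<subseteq> pre q" if "q \<in> set qs" for q
  proof
    fix x assume x: "x \<in> I"
    have "\<zero>\<^bsub>R Quot I\<^esub> \<in> q"
      by (rule additive_subgroup.zero_closed[OF ideal.axioms(1)[OF primeideal.axioms(1)[OF prime[OF that]]]])
    moreover have "\<zero>\<^bsub>R Quot I\<^esub> = I +> x"
      unfolding I.a_rcos_const[OF x] by (simp only: FactRing_def ring_record_simps)
    ultimately show "x \<in> pre q" using I.Icarr[OF x] unfolding pre_def by simp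
  qed
qed

subsection \<open>The minimal primes of \<open>H\<^sub>P\<close>\<close>

lemma ideal_H: "ideal (H_ideal :: ('p::{finite,order} + 'p, 'k::field) mpol set) mpol_ring"
proof -
  interpret R: cring "mpol_ring :: ('p + 'p, 'k) mpol ring" by rule
  show ?thesis unfolding H_ideal_def
    by (rule R.genideal_ideal) (simp add: ring_of_type_algebra_def)
qed

lemma u_gen_in_H:
  assumes "I \<in> poset_ideals"
  shows "u_gen I \<in> (H_ideal :: ('p::{finite,order} + 'p, 'k::field) mpol set)"
proof -
  interpret R: cring "mpol_ring :: ('p + 'p, 'k) mpol ring" by rule
  show ?thesis
    using assms R.genideal_self[of "u_gen ` poset_ideals"]
    unfolding H_ideal_def by (auto simp: ring_of_type_algebra_def)
qed

text \<open>If \<open>p\<close> is in the poset ideal \<open>I\<close>, then x_p divides the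
  generator. Otherwise \<open>q\<close> is not in \<open>I\<close> either, and y_q divides
  it.\<close>

lemma H_ideal_subset_var_ideal:
  fixes p q :: "'p::{finite,order}"
  assumes "p \<le> q"
  shows "H_ideal \<subseteq> (var_ideal {Inl p, Inr q} :: ('p + 'p, 'k::field) mpol set)"
proof -
  let ?V = "var_ideal {Inl p, Inr q} :: ('p + 'p, 'k) mpol set"
  interpret R: cring "mpol_ring :: ('p + 'p, 'k) mpol ring" by rule
  have V: "ideal ?V mpol_ring" by (rule primeideal.axioms(1)[OF primeideal_var_ideal])
  have "u_gen I \<in> ?V" if I: "I \<in> poset_ideals" for I
  proof (cases "p \<in> I")
    case True
    then have "(\<Prod>p\<in>I. mpol_var (Inl p)) \<in> ?V"
      by (intro ideal_prod_closed[OF V, of _ p]) (auto simp: mpol_var_in_var_ideal_iff)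
    then show ?thesis unfolding u_gen_def by (rule ideal_mult_closed[OF V])
  next
    case False
    with I assms have "q \<notin> I" by (auto simp: poset_ideals_def)
    then have "(\<Prod>p\<in>UNIV - I. mpol_var (Inr p)) \<in> ?V"
      by (intro ideal_prod_closed[OF V, of _ q]) (auto simp: mpol_var_in_var_ideal_iff)
    then show ?thesis unfolding u_gen_def by (rule ideal_mult_closed[OF V])
  qed
  then show ?thesis unfolding H_ideal_def by (intro R.genideal_minimal V) auto
qed

text \<open>The supports of the monomials in \<open>H\<^sub>P\<close>.\<close>

definition H_support :: "('p::order + 'p) set \<Rightarrow> bool" where
  "H_support F \<longleftrightarrow> (\<forall>p q. p \<le> q \<longrightarrow> Inl p \<in> F \<or> Inr q \<in> F)"

lemma H_ideal_eq:
  "(H_ideal :: ('p::{finite,order} + 'p, 'k::field) mpol set) =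
     {f. \<forall>m\<in>Poly_Mapping.keys f. H_support (Poly_Mapping.keys m)}"
proof (intro equalityI subsetI CollectI ballI)
  fix f :: "('p + 'p, 'k) mpol" and m
  assume f: "f \<in> H_ideal" and m: "m \<in> Poly_Mapping.keys f"
  show "H_support (Poly_Mapping.keys m)"
    unfolding H_support_def
  proof (intro allI impI)
    fix p q :: 'p assume "p \<le> q"
    then have "f \<in> var_ideal {Inl p, Inr q}" using H_ideal_subset_var_ideal f by blast
    with m show "Inl p \<in> Poly_Mapping.keys m \<or> Inr q \<in> Poly_Mapping.keys m"
      by (auto simp: var_ideal_def)
  qed
next
  fix f :: "('p + 'p, 'k) mpol"
  assume f: "f \<in> {f. \<forall>m\<in>Poly_Mapping.keys f. H_support (Poly_Mapping.keys m)}"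
  have "Poly_Mapping.single m (Poly_Mapping.lookup f m) \<in> H_ideal"
    if m: "m \<in> Poly_Mapping.keys f" for m
  proof -
    have supp: "H_support (Poly_Mapping.keys m)" using f m by blast
    \<comment> \<open>This choice makes u_I divide \<open>m\<close>: for \<open>p\<close> in
      \<open>I\<close> some y_q with \<open>q \<ge> p\<close> is missing, so x_p must occur; for
      \<open>p\<close> outside \<open>I\<close>, the case \<open>q = p\<close> shows that y_p
      occurs.\<close>
    define I where "I = {p. \<exists>q\<ge>p. Inr q \<notin> Poly_Mapping.keys m}"
    let ?W = "Inl ` I \<union> Inr ` (UNIV - I)"
    have "I \<in> poset_ideals" unfolding poset_ideals_def I_def by (blast intro: order_trans)
    then have "u_gen I \<in> (H_ideal :: ('p + 'p, 'k) mpol set)" by (rule u_gen_in_H)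
    moreover have "u_gen I = (\<Prod>v\<in>?W. mpol_var v :: ('p + 'p, 'k) mpol)"
      unfolding u_gen_def
      by (subst prod.union_disjoint) (auto simp: prod.reindex)
    moreover have "?W \<subseteq> Poly_Mapping.keys m"
      using supp by (auto simp: I_def H_support_def)
    ultimately show ?thesis by (intro monomial_mem_ideal[OF ideal_H, of ?W]) auto
  qed
  then show "f \<in> H_ideal"
    by (subst mpol_eq_sum_monomials[of "Poly_Mapping.keys f"]) (auto intro: ideal_sum_closed[OF ideal_H])
qed

lemma prime_above_H:
  fixes Q :: "('p::{finite,order} + 'p, 'k::field) mpol set"
  assumes Q: "primeideal Q mpol_ring" and sub: "H_ideal \<subseteq> Q"
  obtains p q where "p \<le> q" "var_ideal {Inl p, Inr q} \<subseteq> Q"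
proof -
  \<comment> \<open>Since \<open>Q\<close> is prime, a variable of u_I lies in \<open>Q\<close>. It
    cannot be some y_p with \<open>p\<close> outside \<open>I\<close>, by the case
    \<open>q = p\<close>; so it is some x_p with \<open>p\<close> in \<open>I\<close>, and
    \<open>I\<close> provides the matching \<open>q\<close>.\<close>
  define I where "I = {p. \<exists>q\<ge>p. mpol_var (Inr q) \<in> Q}"
  have "I \<in> poset_ideals" unfolding poset_ideals_def I_def by (blast intro: order_trans)
  then have "u_gen I \<in> Q" using u_gen_in_H sub by blast
  then have "(\<Prod>p\<in>I. mpol_var (Inl p)) \<in> Q \<or> (\<Prod>p\<in>UNIV - I. mpol_var (Inr p)) \<in> Q"
    using Q unfolding u_gen_def primeideal_type_algebra_iff by blast
  then obtain p q where pq: "p \<le> q" "mpol_var (Inl p) \<in> Q" "mpol_var (Inr q) \<in> Q"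
    using primeideal_prod_memD[OF Q] unfolding I_def by blast
  have "var_ideal {Inl p, Inr q} \<subseteq> Q"
    by (rule var_ideal_subset_ideal) (use Q pq in \<open>auto simp: primeideal_def\<close>)
  with pq(1) that show thesis by blast
qed

lemma ideal_height_H:
  "ideal_height mpol_ring (H_ideal :: ('p::{finite,order} + 'p, 'k::field) mpol set) = 2"
proof (rule antisym)
  let ?H = "H_ideal :: ('p + 'p, 'k) mpol set"
  have two: "enat (card {Inl p, Inr q :: 'p + 'p}) = 2" for p q
    by (simp add: numeral_eq_enat)
  \<comment> \<open>\<open>undefined\<close> stands for an arbitrary poset element, available
    because types are nonempty; reflexivity makes it a valid pair with itself.\<close>
  have "ideal_height mpol_ring ?H
      \<le> prime_height mpol_ring (var_ideal {Inl undefined, Inr undefined} :: ('p + 'p, 'k) mpol set)"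
    unfolding ideal_height_def using H_ideal_subset_var_ideal[of undefined undefined]
    by (intro INF_lower) (auto intro: primeideal_var_ideal)
  also have "\<dots> \<le> 2" using prime_height_var_ideal_le two by metis
  finally show "ideal_height mpol_ring ?H \<le> 2" .
  show "2 \<le> ideal_height mpol_ring ?H"
    unfolding ideal_height_def
  proof (rule INF_greatest)
    fix Q :: "('p + 'p, 'k) mpol set"
    assume "Q \<in> {Q. primeideal Q mpol_ring \<and> ?H \<subseteq> Q}"
    then have Q: "primeideal Q mpol_ring" "?H \<subseteq> Q" by auto
    from prime_above_H[OF this] obtain p q where "var_ideal {Inl p, Inr q} \<subseteq> Q" by blast
    from prime_height_ge_var_ideal[OF Q(1) this] show "2 \<le> prime_height mpol_ring Q"
      by (simp only: two)
  qed
qed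

text \<open>Chains in the quotient pull back to chains whose least prime contains some (x_p, y_q),
  which gives the upper bound. Conversely, a full chain above such a prime maps to the
  quotient.\<close>

lemma krull_dim_H:
  "krull_dim (mpol_ring Quot (H_ideal :: ('p::{finite,order} + 'p, 'k::field) mpol set)) =
     enat (2 * CARD('p) - 2)"
proof (rule antisym)
  let ?R = "mpol_ring :: ('p + 'p, 'k) mpol ring"
  let ?H = "H_ideal :: ('p + 'p, 'k) mpol set"
  interpret R: cring ?R by rule
  have two: "card {Inl p, Inr q :: 'p + 'p} = 2" for p q by simp
  have vars: "CARD('p + 'p) = 2 * CARD('p)" by simp
  show "krull_dim (?R Quot ?H) \<le> enat (2 * CARD('p) - 2)"
    unfolding krull_dim_def
  proof (rule SUP_least)
    fix qs assume "qs \<in> {qs. prime_chain (?R Quot ?H) qs}"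
    then have qs: "prime_chain (?R Quot ?H) qs" by simp
    define ps where "ps = map (\<lambda>q. {r \<in> carrier ?R. ?H +>\<^bsub>?R\<^esub> r \<in> q}) qs"
    note pre = R.prime_chain_quot_vimage[OF ideal_H qs]
    have ps: "prime_chain ?R ps" unfolding ps_def by (rule pre(1))
    have "primeideal (hd ps) ?R" "?H \<subseteq> hd ps"
      using ps pre(2)[of "hd qs"] qs unfolding ps_def by (auto simp: prime_chain_def hd_map)
    from prime_above_H[OF this] obtain p q where pq: "var_ideal {Inl p, Inr q} \<subseteq> hd ps" by blast
    have "length ps - 1 \<le> CARD('p + 'p) - card {Inl p, Inr q :: 'p + 'p}"
      by (rule prime_chain_above_var_ideal_length_le[OF ps pq])
    then show "enat (length qs - 1) \<le> enat (2 * CARD('p) - 2)"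
      unfolding two vars by (simp add: ps_def)
  qed
  let ?V = "{Inl undefined, Inr undefined :: 'p + 'p}"
  obtain ps where ps: "prime_chain ?R ps" "hd ps = var_ideal ?V" "length ps = card (- ?V) + 1"
    using var_ideal_chain[of ?V "- ?V", where 'k='k] by auto
  have "?H \<subseteq> P" if "P \<in> set ps" for P
  proof -
    have "hd ps \<subseteq> P" using that ps(1) by (cases ps) (auto simp: prime_chain_def)
    with ps(2) H_ideal_subset_var_ideal[of undefined undefined, where 'k='k] show ?thesis by auto
  qed
  from R.prime_chain_quot_image[OF ideal_H ps(1) this]
  have "enat (length (map ((`) ((+>\<^bsub>?R\<^esub>) ?H)) ps) - 1) \<le> krull_dim (?R Quot ?H)"
    unfolding krull_dim_def by (intro SUP_upper) auto
  moreover have "card (- ?V) = 2 * CARD('p) - 2"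
    using vars two by (simp add: Compl_eq_Diff_UNIV card_Diff_subset)
  ultimately show "enat (2 * CARD('p) - 2) \<le> krull_dim (?R Quot ?H)"
    using ps(3) by simp
qed

subsection \<open>Hilbert functions of monomial ideals\<close>

lemma subfield_range_mpol_const: "subfield (range mpol_const) (mpol_ring :: ('v, 'k::field) mpol ring)"
proof -
  let ?K = "ring_of_type_algebra :: 'k ring"
  let ?R = "mpol_ring :: ('v, 'k) mpol ring"
  interpret K: field ?K by rule
  interpret R: cring ?R by rule
  interpret h: ring_hom_ring ?K ?R mpol_const
    by (rule ring_hom_ringI2[OF K.ring_axioms R.ring_axioms])
      (auto simp: ring_hom_def ring_of_type_algebra_def)
  have "\<one>\<^bsub>?R\<^esub> \<noteq> \<zero>\<^bsub>?R\<^esub>" by (simp add: ring_of_type_algebra_def)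
  from h.img_is_subfield(2)[OF K.carrier_is_subfield this] show ?thesis
    by (simp add: ring_of_type_algebra_def)
qed

text \<open>Connects the list-based \<open>Span\<close> with supports, so that spans of monomials
  can be handled through \<open>keys\<close>.\<close>

lemma Span_monomials:
  fixes ms :: "('v \<Rightarrow>\<^sub>0 nat) list"
  shows "ring.Span (mpol_ring :: ('v, 'k::field) mpol ring) (range mpol_const)
      (map (\<lambda>m. Poly_Mapping.single m 1) ms) = {f. Poly_Mapping.keys f \<subseteq> set ms}"
proof (induction ms)
  let ?R = "mpol_ring :: ('v, 'k) mpol ring"
  interpret R: cring ?R by rule
  case Nil
  show ?case by simp (simp add: ring_of_type_algebra_def)
next
  let ?R = "mpol_ring :: ('v, 'k) mpol ring"
  interpret R: cring ?R by rule
  case (Cons m ms)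
  have "f \<in> R.Span (range mpol_const) (map (\<lambda>m. Poly_Mapping.single m 1) (m # ms)) \<longleftrightarrow>
    (\<exists>c g. Poly_Mapping.keys g \<subseteq> set ms \<and> f = mpol_const c * Poly_Mapping.single m 1 + g)" for f
  proof -
    have "R.Span (range mpol_const) (map (\<lambda>m. Poly_Mapping.single m 1) (m # ms)) =
        R.line_extension (range mpol_const) (Poly_Mapping.single m 1) {f. Poly_Mapping.keys f \<subseteq> set ms}"
      using Cons by simp
    then show ?thesis
      by (simp only: R.line_extension_mem_iff) (auto simp: ring_of_type_algebra_def)
  qed
  moreover have "(\<exists>c g. Poly_Mapping.keys g \<subseteq> set ms \<and> f = mpol_const c * Poly_Mapping.single m 1 + g)
    \<longleftrightarrow> Poly_Mapping.keys f \<subseteq> set (m # ms)" for f :: "('v, 'k) mpol"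
  proof
    assume "\<exists>c g. Poly_Mapping.keys g \<subseteq> set ms \<and> f = mpol_const c * Poly_Mapping.single m 1 + g"
    then show "Poly_Mapping.keys f \<subseteq> set (m # ms)"
      by (auto simp: in_keys_iff lookup_add lookup_single when_def split: if_splits)
  next
    assume f: "Poly_Mapping.keys f \<subseteq> set (m # ms)"
    let ?g = "f - mpol_const (Poly_Mapping.lookup f m) * Poly_Mapping.single m 1"
    have "Poly_Mapping.keys ?g \<subseteq> set ms"
      using f by (auto simp: in_keys_iff lookup_minus lookup_single when_def split: if_splits)
    then show "\<exists>c g. Poly_Mapping.keys g \<subseteq> set ms \<and> f = mpol_const c * Poly_Mapping.single m 1 + g"
      by (intro exI[of _ "Poly_Mapping.lookup f m"] exI[of _ ?g]) simp
  qed
  ultimately show ?case by blast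
qed

lemma independent_monomials:
  fixes ms :: "('v \<Rightarrow>\<^sub>0 nat) list"
  assumes "distinct ms"
  shows "ring.independent (mpol_ring :: ('v, 'k::field) mpol ring) (range mpol_const)
      (map (\<lambda>m. Poly_Mapping.single m 1) ms)"
proof -
  let ?R = "mpol_ring :: ('v, 'k) mpol ring"
  interpret R: cring ?R by rule
  show ?thesis using assms
  proof (induction ms)
    case (Cons m ms)
    have "Poly_Mapping.single m 1 \<notin>
        R.Span (range mpol_const) (map (\<lambda>m. Poly_Mapping.single m 1) ms)"
      unfolding Span_monomials using Cons.prems by simp
    moreover have "Poly_Mapping.single m 1 \<in> carrier ?R" by (simp add: ring_of_type_algebra_def)
    ultimately show ?case unfolding list.map using Cons by (intro R.li_Cons) auto
  qed simp
qed

lemma minus_type_algebra: "a \<ominus>\<^bsub>ring_of_type_algebra\<^esub> b = a - (b :: 'a::comm_ring_1)"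
proof -
  interpret R: cring "ring_of_type_algebra :: 'a ring" by rule
  have "\<ominus>\<^bsub>ring_of_type_algebra\<^esub> b = - b"
    by (rule R.minus_equality) (auto simp: ring_of_type_algebra_def)
  then show ?thesis by (simp add: a_minus_def ring_of_type_algebra_def)
qed

lemma monom_deg_eq: "monom_deg (m :: 'v::finite \<Rightarrow>\<^sub>0 nat) = (\<Sum>v\<in>UNIV. Poly_Mapping.lookup m v)"
  unfolding monom_deg_def by (rule sum.mono_neutral_left) (auto simp: in_keys_iff)

lemma finite_monom_deg: "finite {m :: 'v::finite \<Rightarrow>\<^sub>0 nat. monom_deg m = n}"
proof (rule finite_subset[OF _ card_bounded_exponents(1)[of n]])
  show "{m :: 'v \<Rightarrow>\<^sub>0 nat. monom_deg m = n} \<subseteq> {m. \<forall>v. Poly_Mapping.lookup m v \<le> n}"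
    by (auto simp: monom_deg_eq intro: member_le_sum)
qed

text \<open>The classes of the degree \<open>n\<close> monomials outside \<open>I\<close> form a
  basis. The condition on \<open>0\<close> says that \<open>1\<close> is not in \<open>I\<close>, so
  the constants still form a field in the quotient.\<close>

lemma hilbert_fun_monomial_ideal:
  fixes I :: "('v::finite, 'k::field) mpol set"
  assumes ideal: "ideal I mpol_ring" and I: "I = {f. \<forall>m\<in>Poly_Mapping.keys f. Q m}" and "\<not> Q 0"
  shows "hilbert_fun I n = card {m. monom_deg m = n \<and> \<not> Q m}"
proof -
  let ?R = "mpol_ring :: ('v, 'k) mpol ring"
  let ?K = "range mpol_const :: ('v, 'k) mpol set"
  interpret R: cring ?R by rule
  interpret I: ideal I ?R by fact
  interpret h: ring_hom_ring ?R "?R Quot I" "(+>\<^bsub>?R\<^esub>) I" by (rule I.rcos_ring_hom_ring)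
  have coset_eq: "I +>\<^bsub>?R\<^esub> f = I +>\<^bsub>?R\<^esub> g \<longleftrightarrow> f - g \<in> I" for f g
    using R.quotient_eq_iff_same_a_r_cos[OF ideal, of f g]
    by (simp add: minus_type_algebra) (simp add: ring_of_type_algebra_def)
  have "1 \<notin> I" using \<open>\<not> Q 0\<close> by (simp add: I)
  have one: "\<one>\<^bsub>?R Quot I\<^esub> \<noteq> \<zero>\<^bsub>?R Quot I\<^esub>"
  proof
    assume "\<one>\<^bsub>?R Quot I\<^esub> = \<zero>\<^bsub>?R Quot I\<^esub>"
    then have "I +>\<^bsub>?R\<^esub> 1 = I" by (simp add: FactRing_def ring_of_type_algebra_def)
    also have "I = I +>\<^bsub>?R\<^esub> 0"
      using I.a_rcos_const[of 0] by (simp add: I)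
    finally show False using \<open>1 \<notin> I\<close> by (simp add: coset_eq)
  qed
  obtain ms where ms: "distinct ms" "set ms = {m. monom_deg m = n \<and> \<not> Q m}"
    using finite_distinct_list[of "{m. monom_deg m = n \<and> \<not> Q m}"]
      finite_subset[OF _ finite_monom_deg[of n]] by (metis (mono_tags, lifting) mem_Collect_eq subsetI)
  define Us where "Us = map (\<lambda>m. Poly_Mapping.single m 1 :: ('v, 'k) mpol) ms"
  have Span: "R.Span ?K Us = {f. Poly_Mapping.keys f \<subseteq> set ms}"
    unfolding Us_def by (rule Span_monomials)
  have carr: "set Us \<subseteq> carrier ?R" "?K \<subseteq> carrier ?R" by (simp_all add: ring_of_type_algebra_def)
  \<comment> \<open>A difference lying in \<open>I\<close> has all its monomials in
    \<open>I\<close>, while elements of the span have none there; injectivity carries independence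
    to the quotient.\<close>
  have "inj_on ((+>\<^bsub>?R\<^esub>) I) (R.Span ?K Us)"
    unfolding Span
  proof (rule inj_onI)
    fix f g assume fg: "f \<in> {f. Poly_Mapping.keys f \<subseteq> set ms}" "g \<in> {f. Poly_Mapping.keys f \<subseteq> set ms}"
      and "I +>\<^bsub>?R\<^esub> f = I +>\<^bsub>?R\<^esub> g"
    then have "f - g \<in> I" by (simp add: coset_eq)
    then have "Poly_Mapping.keys (f - g) \<subseteq> {m. Q m}" by (auto simp: I)
    moreover have "Poly_Mapping.keys (f - g) \<subseteq> set ms"
      using fg by (simp add: subset_iff in_keys_iff lookup_minus) metis
    ultimately have "Poly_Mapping.keys (f - g) = {}" unfolding ms(2) by blast
    then have "f - g = 0" by (simp only: keys_eq_empty)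
    then show "f = g" by simp
  qed
  then have "ring.independent (?R Quot I) ((+>\<^bsub>?R\<^esub>) I ` ?K) (map ((+>\<^bsub>?R\<^esub>) I) Us)"
    using independent_monomials[OF ms(1)] unfolding Us_def
    by (intro h.inj_hom_preserves_independent[OF subfield_range_mpol_const one])
  moreover have "ring.Span (?R Quot I) ((+>\<^bsub>?R\<^esub>) I ` ?K) (map ((+>\<^bsub>?R\<^esub>) I) Us) =
      (+>\<^bsub>?R\<^esub>) I ` homog_part n"
  proof -
    have "(+>\<^bsub>?R\<^esub>) I ` R.Span ?K Us = (+>\<^bsub>?R\<^esub>) I ` homog_part n"
    proof (intro equalityI subsetI)
      fix C assume "C \<in> (+>\<^bsub>?R\<^esub>) I ` R.Span ?K Us"
      then show "C \<in> (+>\<^bsub>?R\<^esub>) I ` homog_part n" using ms(2) unfolding Span homog_part_def by blast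
    next
      fix C assume "C \<in> (+>\<^bsub>?R\<^esub>) I ` homog_part n"
      then obtain f where f: "f \<in> homog_part n" "C = I +>\<^bsub>?R\<^esub> f" by blast
      \<comment> \<open>Discarding the monomials of \<open>f\<close> that lie in \<open>I\<close>
        does not change its coset.\<close>
      define g where "g = (\<Sum>m\<in>set ms. Poly_Mapping.single m (Poly_Mapping.lookup f m))"
      have g: "Poly_Mapping.lookup g m = (if m \<in> set ms then Poly_Mapping.lookup f m else 0)" for m
        unfolding g_def by (simp add: lookup_sum lookup_single when_def sum.delta cong: if_cong)
      have "Poly_Mapping.keys g \<subseteq> set ms" by (auto simp: in_keys_iff g split: if_splits)
      moreover have "f - g \<in> I"
        unfolding I using f(1) ms(2)
        by (auto simp: in_keys_iff lookup_minus g homog_part_def split: if_splits)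
      ultimately show "C \<in> (+>\<^bsub>?R\<^esub>) I ` R.Span ?K Us"
        using f(2) coset_eq unfolding Span by blast
    qed
    then show ?thesis using h.Span_hom[OF carr(2,1)] by simp
  qed
  ultimately have "h.S.dimension (length (map ((+>\<^bsub>?R\<^esub>) I) Us)) ((+>\<^bsub>?R\<^esub>) I ` ?K)
      ((+>\<^bsub>?R\<^esub>) I ` homog_part n)"
    by (intro h.S.dimensionI h.img_is_subfield(2)[OF subfield_range_mpol_const one])
  from h.S.dimI[OF h.img_is_subfield(2)[OF subfield_range_mpol_const one] this]
  have "hilbert_fun I n = length ms"
    unfolding hilbert_fun_def over_def by (simp add: Us_def image_image)
  then show ?thesis using ms distinct_card by metis
qed

subsection \<open>The Hilbert series of \<open>S/H\<^sub>P\<close>\<close>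

definition monoms_supp :: "'v set \<Rightarrow> nat \<Rightarrow> ('v \<Rightarrow>\<^sub>0 nat) set" where
  "monoms_supp F n = {m. Poly_Mapping.keys m = F \<and> monom_deg m = n}"

lemma finite_monoms_supp: "finite (monoms_supp (F :: 'v::finite set) n)"
  by (rule finite_subset[OF _ finite_monom_deg[of n]]) (auto simp: monoms_supp_def)

lemma monom_deg_add_single:
  fixes m :: "'v::finite \<Rightarrow>\<^sub>0 nat"
  shows "monom_deg (m + Poly_Mapping.single v 1) = Suc (monom_deg m)"
  by (simp add: monom_deg_eq lookup_add lookup_single sum.distrib when_def)

text \<open>Dividing by the variable \<open>v\<close> removes \<open>v\<close> from the support
  exactly when its exponent was 1.\<close>

lemma monoms_supp_insert:
  fixes F :: "'v::finite set"
  assumes "v \<notin> F"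
  shows "monoms_supp (insert v F) 0 = {}"
    and "card (monoms_supp (insert v F) (Suc n)) =
      card (monoms_supp F n) + card (monoms_supp (insert v F) n)"
proof -
  show "monoms_supp (insert v F) 0 = {}"
  proof (rule equals0I)
    fix m assume "m \<in> monoms_supp (insert v F) 0"
    then have "v \<in> Poly_Mapping.keys m" "Poly_Mapping.lookup m v = 0"
      by (auto simp: monoms_supp_def monom_deg_eq)
    then show False by (simp add: in_keys_iff)
  qed
  let ?f = "\<lambda>m :: 'v \<Rightarrow>\<^sub>0 nat. m + Poly_Mapping.single v 1"
  have "monoms_supp (insert v F) (Suc n) = ?f ` (monoms_supp F n \<union> monoms_supp (insert v F) n)"
  proof (intro equalityI subsetI)
    fix m assume m: "m \<in> monoms_supp (insert v F) (Suc n)"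
    let ?m = "m - Poly_Mapping.single v 1"
    have v: "v \<in> Poly_Mapping.keys m" using m by (auto simp: monoms_supp_def)
    then have eq: "m = ?f ?m"
      by (intro poly_mapping_eqI) (auto simp: lookup_add lookup_minus lookup_single in_keys_iff when_def)
    have "monom_deg ?m = n"
      using m monom_deg_add_single[of ?m v] unfolding eq[symmetric] by (simp add: monoms_supp_def)
    moreover have "Poly_Mapping.keys m = insert v (Poly_Mapping.keys ?m)"
      by (subst eq) (simp add: keys_add_nat)
    then have "insert v F = insert v (Poly_Mapping.keys ?m)" using m by (simp add: monoms_supp_def)
    then have "Poly_Mapping.keys ?m = F \<or> Poly_Mapping.keys ?m = insert v F"
      using assms by (cases "v \<in> Poly_Mapping.keys ?m") auto
    ultimately have "?m \<in> monoms_supp F n \<union> monoms_supp (insert v F) n"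
      by (auto simp: monoms_supp_def)
    then show "m \<in> ?f ` (monoms_supp F n \<union> monoms_supp (insert v F) n)"
      using eq by blast
  next
    fix m assume "m \<in> ?f ` (monoms_supp F n \<union> monoms_supp (insert v F) n)"
    then obtain m' where m': "m = ?f m'" "m' \<in> monoms_supp F n \<union> monoms_supp (insert v F) n" by blast
    have "Poly_Mapping.keys m = insert v (Poly_Mapping.keys m')" "monom_deg m = Suc (monom_deg m')"
      unfolding m'(1) by (simp add: keys_add_nat, rule monom_deg_add_single)
    with m'(2) show "m \<in> monoms_supp (insert v F) (Suc n)" by (auto simp: monoms_supp_def)
  qed
  moreover have "inj ?f" by (simp add: inj_def)
  moreover have "monoms_supp F n \<inter> monoms_supp (insert v F) n = {}"
    using assms by (auto simp: monoms_supp_def)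
  ultimately show "card (monoms_supp (insert v F) (Suc n)) =
      card (monoms_supp F n) + card (monoms_supp (insert v F) n)"
    by (simp add: card_image inj_on_subset[of ?f UNIV] card_Un_disjoint finite_monoms_supp)
qed

text \<open>The series is \<open>(t / (1 - t)) ^ card F\<close>, stated without denominators. The
  recurrence for a new variable reads \<open>A' = t * (A + A')\<close>.\<close>

lemma monoms_supp_series:
  fixes F :: "'v::finite set"
  shows "Abs_fps (\<lambda>n. int (card (monoms_supp F n))) * (1 - fps_X) ^ card F = fps_X ^ card F"
proof -
  have "finite F" by simp
  then show ?thesis
  proof (induction F rule: finite_induct)
    case empty
    have "monoms_supp {} n = (if n = 0 then {0 :: 'v \<Rightarrow>\<^sub>0 nat} else {})" for n
      by (auto simp: monoms_supp_def monom_deg_def)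
    then show ?case by (simp add: fps_eq_iff)
  next
    case (insert v F)
    let ?A = "\<lambda>F :: 'v set. Abs_fps (\<lambda>n. int (card (monoms_supp F n)))"
    have "?A (insert v F) = fps_X * (?A F + ?A (insert v F))"
    proof (rule fps_ext)
      show "?A (insert v F) $ n = (fps_X * (?A F + ?A (insert v F))) $ n" for n
        using monoms_supp_insert[OF insert.hyps(2)] by (cases n) (simp_all add: fps_X_mult_nth)
    qed
    then have "?A (insert v F) * (1 - fps_X) = fps_X * ?A F" by (simp add: algebra_simps)
    then have "?A (insert v F) * (1 - fps_X) * (1 - fps_X) ^ card F =
      fps_X * (?A F * (1 - fps_X) ^ card F)" by (simp add: mult.assoc)
    then show ?case using insert by (simp add: mult.assoc)
  qed
qed

text \<open>The faces of the simplicial complex whose Stanley--Reisner ideal is \<open>H\<^sub>P\<close>.\<close>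

definition H_faces :: "('p::order + 'p) set set" where
  "H_faces = {F. \<not> H_support F}"

text \<open>Membership in the ideal depends only on the support of a monomial, so the monomials
  outside it are grouped by support.\<close>

lemma hilbert_series_H:
  "hilbert_series (H_ideal :: ('p::{finite,order} + 'p, 'k::field) mpol set) =
    (\<Sum>F\<in>(H_faces :: ('p + 'p) set set). Abs_fps (\<lambda>n. int (card (monoms_supp F n))))"
proof (rule fps_ext)
  fix n
  have "\<not> H_support (Poly_Mapping.keys (0 :: 'p + 'p \<Rightarrow>\<^sub>0 nat))"
    by (auto simp: H_support_def)
  then have "hilbert_fun (H_ideal :: ('p + 'p, 'k) mpol set) n =
      card {m :: 'p + 'p \<Rightarrow>\<^sub>0 nat. monom_deg m = n \<and> \<not> H_support (Poly_Mapping.keys m)}"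
    by (rule hilbert_fun_monomial_ideal[OF ideal_H H_ideal_eq])
  also have "{m :: 'p + 'p \<Rightarrow>\<^sub>0 nat. monom_deg m = n \<and> \<not> H_support (Poly_Mapping.keys m)} =
      (\<Union>F\<in>(H_faces :: ('p + 'p) set set). monoms_supp F n)"
    by (auto simp: monoms_supp_def H_faces_def)
  also have "card \<dots> = (\<Sum>F\<in>(H_faces :: ('p + 'p) set set). card (monoms_supp F n))"
    by (rule card_UN_disjoint) (auto simp: finite_monoms_supp, auto simp: monoms_supp_def)
  finally show "hilbert_series (H_ideal :: ('p + 'p, 'k) mpol set) $ n =
      (\<Sum>F\<in>H_faces. Abs_fps (\<lambda>n. int (card (monoms_supp (F :: ('p + 'p) set) n)))) $ n"
    by (simp add: hilbert_series_def fps_sum_nth)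
qed

section \<open>Faces of maximal size\<close>

lemma H_facesE:
  fixes F :: "('p::{finite,order} + 'p) set"
  assumes "F \<in> H_faces"
  obtains p q where "p \<le> q" "F \<subseteq> - {Inl p, Inr q}"
  using assms by (auto simp: H_faces_def H_support_def)

lemma card_Compl_pair: "card (- {Inl p, Inr q :: 'p::finite + 'p}) = 2 * CARD('p) - 2"
  by (simp add: Compl_eq_Diff_UNIV card_Diff_subset)

lemma card_H_faces_le:
  fixes F :: "('p::{finite,order} + 'p) set"
  assumes "F \<in> H_faces"
  shows "card F \<le> 2 * CARD('p) - 2"
  using assms card_Compl_pair by (metis H_facesE card_mono finite)

text \<open>Each face lies in the complement of some {x_p, y_q} with \<open>p \<le> q\<close>, and
  equals it when the sizes agree. The tags \<open>Inl\<close> and \<open>Inr\<close> let the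
  complement recover the ordered pair.\<close>

lemma card_H_facets:
  "card {F \<in> (H_faces :: ('p::{finite,order} + 'p) set set). card F = 2 * CARD('p) - 2} =
     card {(p :: 'p, q :: 'p). p \<le> q}"
proof (rule sym, rule bij_betw_same_card)
  show "bij_betw (\<lambda>(p, q). - {Inl p, Inr q}) {(p :: 'p, q). p \<le> q}
      {F \<in> H_faces. card F = 2 * CARD('p) - 2}"
    unfolding bij_betw_def
  proof (intro conjI equalityI subsetI)
    show "inj_on (\<lambda>(p, q). - {Inl p, Inr q :: 'p + 'p}) {(p, q). p \<le> q}"
      by (auto simp: inj_on_def doubleton_eq_iff)
    fix F assume "F \<in> (\<lambda>(p, q). - {Inl p, Inr q :: 'p + 'p}) ` {(p, q). p \<le> q}"
    then show "F \<in> {F \<in> H_faces. card F = 2 * CARD('p) - 2}"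
      by (auto simp: H_faces_def H_support_def card_Compl_pair)
  next
    fix F assume F: "F \<in> {F \<in> (H_faces :: ('p + 'p) set set). card F = 2 * CARD('p) - 2}"
    then obtain p q :: 'p where pq: "p \<le> q" "F \<subseteq> - {Inl p, Inr q}" by (auto elim: H_facesE)
    then have "F = - {Inl p, Inr q}" using F card_Compl_pair[of p q] by (intro card_subset_eq) auto
    with pq show "F \<in> (\<lambda>(p, q). - {Inl p, Inr q}) ` {(p, q). p \<le> q}" by force
  qed
qed

lemma multiplicity_H:
  "multiplicity_quot (H_ideal :: ('p::{finite,order} + 'p, 'k::field) mpol set) =
     int (card {(p :: 'p, q :: 'p). p \<le> q})"
proof -
  let ?H = "H_ideal :: ('p + 'p, 'k) mpol set"
  define d where "d = 2 * CARD('p) - 2"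
  \<comment> \<open>The numerator over the common denominator \<open>(1 - t) ^ d\<close>: each face
    contributes \<open>(t / (1 - t)) ^ card F\<close>.\<close>
  define Q :: "int poly" where
    "Q = (\<Sum>F\<in>(H_faces :: ('p + 'p) set set). [:0, 1:] ^ card F * [:1, -1:] ^ (d - card F))"
  have lin: "fps_of_poly [:1, -1:] = (1 - fps_X :: int fps)" "fps_of_poly [:0, 1:] = (fps_X :: int fps)"
    by (simp_all add: fps_of_poly_pCons)
  have "hilbert_series ?H * (1 - fps_X) ^ d =
      (\<Sum>F\<in>H_faces. Abs_fps (\<lambda>n. int (card (monoms_supp (F :: ('p + 'p) set) n))) * (1 - fps_X) ^ d)"
    by (simp add: hilbert_series_H sum_distrib_right)
  also have "\<dots> = (\<Sum>F\<in>(H_faces :: ('p + 'p) set set). fps_X ^ card F * (1 - fps_X) ^ (d - card F))"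
  proof (intro sum.cong refl)
    fix F :: "('p + 'p) set" assume "F \<in> H_faces"
    then have "card F + (d - card F) = d" using card_H_faces_le[of F] by (simp add: d_def)
    then have "(1 - fps_X :: int fps) ^ d = (1 - fps_X) ^ card F * (1 - fps_X) ^ (d - card F)"
      by (metis power_add)
    then show "Abs_fps (\<lambda>n. int (card (monoms_supp F n))) * (1 - fps_X) ^ d =
        fps_X ^ card F * (1 - fps_X) ^ (d - card F)"
      by (simp only: mult.assoc[symmetric] monoms_supp_series)
  qed
  also have "\<dots> = fps_of_poly Q"
    by (simp only: Q_def fps_of_poly_sum fps_of_poly_mult fps_of_poly_power lin)
  finally have Q: "hilbert_series ?H * (1 - fps_X) ^ d = fps_of_poly Q" .
  \<comment> \<open>The map \<open>fps_of_poly\<close> is injective, so the definite description in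
    the definition selects this \<open>Q\<close>.\<close>
  have "multiplicity_quot ?H = poly Q 1"
    unfolding multiplicity_quot_def krull_dim_H by (simp add: Q d_def[symmetric])
  \<comment> \<open>At 1 the summand is \<open>0 ^ (d - card F)\<close>; no face exceeds size
    \<open>d\<close>, so it equals 1 exactly for the faces of size \<open>d\<close>.\<close>
  also have "\<dots> = (\<Sum>F\<in>(H_faces :: ('p + 'p) set set). if card F = d then 1 else 0)"
    unfolding Q_def poly_sum
    using card_H_faces_le by (intro sum.cong refl) (force simp: d_def)
  also have "\<dots> = int (card {F \<in> (H_faces :: ('p + 'p) set set). card F = d})"
    by (simp flip: sum.inter_filter)
  also have "\<dots> = int (card {(p :: 'p, q :: 'p). p \<le> q})"
    unfolding d_def card_H_facets ..
  finally show ?thesis .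
qed

theorem proposition2p4:
  shows "ideal_height mpol_ring (H_ideal :: ('p::{finite,order} + 'p, 'k::field) mpol set) = 2 \<and>
         multiplicity_quot (H_ideal :: ('p + 'p, 'k) mpol set) =
           int (card {(p :: 'p, q :: 'p). p \<le> q})"
  by (simp add: ideal_height_H multiplicity_H)

end
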